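(* Let $m\ge1$ and let $\phi\in C^\infty(\mathbb R^2)$ satisfy, for some $C>0$ and all $z\in\mathbb R^2$, $|D^3\phi(z)|\le C|z|^{2m-1}$, $|D^2\phi(z)|\le C|z|^{2m}$, $|D\phi(z)|\le C|z|^{2m+1}$. Let $\mathrm{epi}(\phi)=\{(z,t)\in\mathbb R^3:t>\phi(z)\}$. There exist constants $\varepsilon_0>0$ and $\lambda>0$ such that for every $z\in\mathbb R^2$ with $-XF(z)>\frac12|ZF(z)|$ and every $t$ with $(z,t)\in\mathrm{epi}(\phi)$, the curve $\gamma:[0,\infty)\to\mathbb R^3$, $$\gamma(s)=\begin{cases}e^{sX}(z,t), & 0\le s\le\bar s:=\varepsilon_0\dfrac{|ZF(z)|}{|z|^{2m}},\\[2mm] \gamma(\bar s)+(0,0,s-\bar s), & s\ge\bar s,\end{cases}$$ satisfies $\gamma([0,\infty))\subset\mathrm{epi}(\phi)$ and $B\big(\gamma(s),\lambda\operatorname{diam}(\gamma|_{[0,s]})\big)\subset\mathrm{epi}(\phi)$ for all $s>0$.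
   Context: Write points of $\mathbb R^3=\mathbb C\times\mathbb R$ as $(z,t)=(x,y,t)$. For a real parameter $m\ge1$ consider the vector fields $X=\partial_x+|z|^{2m}y\,\partial_t$ and $Y=\partial_y-|z|^{2m}x\,\partial_t$. An absolutely continuous curve $\gamma:[0,1]\to\mathbb R^3$ is horizontal if $\dot\gamma(s)=\alpha(s)X(\gamma(s))+\beta(s)Y(\gamma(s))$ for a.e. $s$, with length $\int_0^1|(\alpha(s),\beta(s))|\,ds$; the Carnot–Carathéodory distance $d(p,q)$ is the infimum of lengths of horizontal curves joining $p$ to $q$, $B(p,r)=\{q:d(p,q)<r\}$, and diameters are taken with respect to $d$. For $z=(x,y)$, $XF(z)=\phi_x(z)-|z|^{2m}y$, $YF(z)=\phi_y(z)+|z|^{2m}x$, $ZF(z)=(XF(z),YF(z))$ (note $ZF(z)\neq0$ forces $z\ne0$ under the hypotheses). $e^{sX}(z,t)$ denotes the point at time $s$ of the integral curve of $X$ starting at $(z,t)$; explicitly $e^{sX}(z,t)=(x+s,\,y,\,t+y\int_0^s|(x+\rho,y)|^{2m}d\rho)$. $|D^k\phi(z)|$ is the maximum of the absolute values of all $k$-th order partial derivatives of $\phi$ at $z$. *)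

theory Defs
  imports "HOL-Analysis.Analysis"
begin

type_synonym pt = "(real \<times> real) \<times> real"

definition abs_cont_on :: "real \<Rightarrow> real \<Rightarrow> (real \<Rightarrow> 'a::real_normed_vector) \<Rightarrow> bool" where
  "abs_cont_on a b f \<longleftrightarrow>
     (\<forall>e>0. \<exists>d>0. \<forall>(n::nat) (l::nat \<Rightarrow> real) (r::nat \<Rightarrow> real).
        (\<forall>k<n. a \<le> l k \<and> l k \<le> r k \<and> r k \<le> b) \<and>
        (\<forall>i<n. \<forall>j<n. i \<noteq> j \<longrightarrow> r i \<le> l j \<or> r j \<le> l i) \<and>
        (\<Sum>k<n. r k - l k) < d \<longrightarrow>
        (\<Sum>k<n. norm (f (r k) - f (l k))) < e)"

definition Xf :: "real \<Rightarrow> pt \<Rightarrow> pt" where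
  "Xf m p = (case p of ((x, y), t) \<Rightarrow> ((1, 0), norm (x, y) powr (2 * m) * y))"

definition Yf :: "real \<Rightarrow> pt \<Rightarrow> pt" where
  "Yf m p = (case p of ((x, y), t) \<Rightarrow> ((0, 1), - (norm (x, y) powr (2 * m) * x)))"

definition horizontal :: "real \<Rightarrow> (real \<Rightarrow> pt) \<Rightarrow> (real \<Rightarrow> real) \<Rightarrow> (real \<Rightarrow> real) \<Rightarrow> bool" where
  "horizontal m \<gamma> \<alpha> \<beta> \<longleftrightarrow>
     abs_cont_on 0 1 \<gamma> \<and> \<alpha> \<in> borel_measurable lebesgue \<and> \<beta> \<in> borel_measurable lebesgue \<and>
     (AE s in lebesgue. s \<in> {0..1} \<longrightarrow>
        (\<gamma> has_vector_derivative (\<alpha> s *\<^sub>R Xf m (\<gamma> s) + \<beta> s *\<^sub>R Yf m (\<gamma> s))) (at s within {0..1}))"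

definition curve_length :: "(real \<Rightarrow> real) \<Rightarrow> (real \<Rightarrow> real) \<Rightarrow> ennreal" where
  "curve_length \<alpha> \<beta> = (\<integral>\<^sup>+ s. ennreal (norm (\<alpha> s, \<beta> s)) * indicator {0..1} s \<partial>lebesgue)"

text \<open>Carnot-Caratheodory distance (ennreal-valued; infimum of the empty set is infinity).\<close>
definition cc_dist :: "real \<Rightarrow> pt \<Rightarrow> pt \<Rightarrow> ennreal" where
  "cc_dist m p q = (INF L \<in> {curve_length \<alpha> \<beta> | \<gamma> \<alpha> \<beta>.
        horizontal m \<gamma> \<alpha> \<beta> \<and> \<gamma> 0 = p \<and> \<gamma> 1 = q}. L)"

definition cc_ball :: "real \<Rightarrow> pt \<Rightarrow> ennreal \<Rightarrow> pt set" where
  "cc_ball m p r = {q. cc_dist m p q < r}"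

definition cc_diam :: "real \<Rightarrow> pt set \<Rightarrow> ennreal" where
  "cc_diam m A = (SUP pq \<in> A \<times> A. cc_dist m (fst pq) (snd pq))"

definition pd :: "bool \<Rightarrow> (real \<times> real \<Rightarrow> real) \<Rightarrow> real \<times> real \<Rightarrow> real" where
  "pd b g z = frechet_derivative g (at z) (if b then (0, 1) else (1, 0))"

fun dpart :: "bool list \<Rightarrow> (real \<times> real \<Rightarrow> real) \<Rightarrow> real \<times> real \<Rightarrow> real" where
  "dpart [] g = g"
| "dpart (b # bs) g = pd b (dpart bs g)"

definition smooth2 :: "(real \<times> real \<Rightarrow> real) \<Rightarrow> bool" where
  "smooth2 \<phi> \<longleftrightarrow> (\<forall>bs z. dpart bs \<phi> differentiable (at z))"

definition Dnorm :: "nat \<Rightarrow> (real \<times> real \<Rightarrow> real) \<Rightarrow> real \<times> real \<Rightarrow> real" where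
  "Dnorm k \<phi> z = Max {\<bar>dpart bs \<phi> z\<bar> | bs. length bs = k}"

definition XF :: "real \<Rightarrow> (real \<times> real \<Rightarrow> real) \<Rightarrow> real \<times> real \<Rightarrow> real" where
  "XF m \<phi> z = pd False \<phi> z - norm z powr (2 * m) * snd z"

definition YF :: "real \<Rightarrow> (real \<times> real \<Rightarrow> real) \<Rightarrow> real \<times> real \<Rightarrow> real" where
  "YF m \<phi> z = pd True \<phi> z + norm z powr (2 * m) * fst z"

definition ZF :: "real \<Rightarrow> (real \<times> real \<Rightarrow> real) \<Rightarrow> real \<times> real \<Rightarrow> real \<times> real" where
  "ZF m \<phi> z = (XF m \<phi> z, YF m \<phi> z)"

definition epi :: "(real \<times> real \<Rightarrow> real) \<Rightarrow> pt set" where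
  "epi \<phi> = {(z, t). t > \<phi> z}"

definition expX :: "real \<Rightarrow> real \<Rightarrow> pt \<Rightarrow> pt" where
  "expX m s p = (case p of ((x, y), t) \<Rightarrow>
     ((x + s, y), t + y * integral {0..s} (\<lambda>\<rho>. norm (x + \<rho>, y) powr (2 * m))))"

definition gam :: "real \<Rightarrow> (real \<times> real \<Rightarrow> real) \<Rightarrow> real \<Rightarrow> real \<times> real \<Rightarrow> real \<Rightarrow> real \<Rightarrow> pt" where
  "gam m \<phi> eps0 z t s =
     (let sbar = eps0 * norm (ZF m \<phi> z) / norm z powr (2 * m) in
      if s \<le> sbar then expX m s (z, t)
      else expX m sbar (z, t) + ((0, 0), s - sbar))"

end

theory Submission
  imports Defs
begin

text \<open>Write \<open>N = |ZF(z)|\<close>. On \<open>{|w| \<le> R}\<close> the map \<open>ZF\<close> is Lipschitz with constant of order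
  \<open>R\<^sup>2\<^sup>m\<close>, so for small \<open>\<epsilon>\<^sub>0\<close> the function \<open>F = \<phi>(z) - t\<close> decreases along \<open>\<gamma>\<close> at rate at least
  \<open>N/4\<close> up to the time \<open>\<sigma> = \<epsilon>\<^sub>0 N/|z|\<^sup>2\<^sup>m\<close> and at rate 1 afterwards. Over a ball of radius \<open>r\<close> it
  changes by at most \<open>r\<close> times the supremum of \<open>|ZF|\<close>. The diameter of \<open>\<gamma>\<close> up to time \<open>s \<le> \<sigma>\<close> is at
  most \<open>s\<close>; after that a vertical segment of height \<open>h\<close> at distance \<open>R\<close> from the axis contributes at
  most \<open>5\<rho>\<close>, where \<open>h = \<rho>\<^sup>2R\<^sup>2\<^sup>m\<close> if \<open>\<rho> \<le> R\<close> and \<open>h = \<rho>\<^sup>2\<^sup>m\<^sup>+\<^sup>2\<close> otherwise. In either regime the drop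
  \<open>N\<sigma>/4 + h\<close> beats the variation of \<open>F\<close> over the ball once \<open>\<lambda>\<close> is small.\<close>

section \<open>Absolutely continuous functions and the fundamental theorem of calculus\<close>

text \<open>Only upper bounds for the diameter enter: enlarging the radius enlarges the ball, so
  explicit curves suffice and no lower bound for the distance is needed. Put
  \<open>P = |z|^(2m)\<close> and let \<open>K * P\<close> be the Lipschitz constant of
  \<open>ZF\<close> on the disc of radius \<open>|z|\<close> about \<open>z\<close>. With
  \<open>eps0 = 1 / (4 * K)\<close> one gets \<open>N = 4 * K * P * \<sigma>\<close>, so
  \<open>XF\<close> uses up only half of its margin \<open>N / 2\<close> before time
  \<open>\<sigma>\<close>, and the drop there is \<open>K * P * \<sigma>^2\<close>. Drop and
  variation are thus both quadratic in \<open>\<sigma>\<close> and \<open>\<rho>\<close>, but the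
  variation carries the factor \<open>K * lam\<close>; hence one \<open>lam\<close> serves every
  \<open>z\<close>. Two regimes arise because \<open>|z|^(2m)\<close> degenerates on the axis:
  \<open>\<rho>\<close> is the size of a horizontal loop whose net height is \<open>h\<close>, and
  this scales differently once the loop is wider than its distance to the axis. The analytic
  obstacle is that competing curves are merely absolutely continuous, with a velocity almost
  everywhere. The variation estimate therefore rests on a fundamental theorem of calculus for such
  functions, proved for the gauge integral because a gauge can treat tags in the null set
  separately.\<close>

lemma abs_cont_onD:
  assumes "abs_cont_on a b f" "e > 0"
  obtains d where "d > 0"
    "\<And>(n::nat) l r. \<lbrakk>\<And>k. k < n \<Longrightarrow> a \<le> l k \<and> l k \<le> r k \<and> r k \<le> b;
        \<And>i j. \<lbrakk>i < n; j < n; i \<noteq> j\<rbrakk> \<Longrightarrow> r i \<le> l j \<or> r j \<le> l i; (\<Sum>k<n. r k - l k) < d\<rbrakk> \<Longrightarrow>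
        (\<Sum>k<n. norm (f (r k) - f (l k))) < e"
proof -
  obtain d where d: "d > 0" "\<forall>(n::nat) l r. (\<forall>k<n. a \<le> l k \<and> l k \<le> r k \<and> r k \<le> b) \<and>
        (\<forall>i<n. \<forall>j<n. i \<noteq> j \<longrightarrow> r i \<le> l j \<or> r j \<le> l i) \<and> (\<Sum>k<n. r k - l k) < d \<longrightarrow>
        (\<Sum>k<n. norm (f (r k) - f (l k))) < e"
    using assms(1)[unfolded abs_cont_on_def, THEN spec, THEN mp, OF assms(2)] by (elim exE conjE)
  show thesis
    by (rule that[OF d(1)], rule d(2)[rule_format]) blast
qed

lemma abs_cont_onI:
  assumes "\<And>e. e > 0 \<Longrightarrow> \<exists>d>0. \<forall>(n::nat) l r. (\<forall>k<n. a \<le> l k \<and> l k \<le> r k \<and> r k \<le> b) \<longrightarrow>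
        (\<forall>i<n. \<forall>j<n. i \<noteq> j \<longrightarrow> r i \<le> l j \<or> r j \<le> l i) \<longrightarrow> (\<Sum>k<n. r k - l k) < d \<longrightarrow>
        (\<Sum>k<n. norm (f (r k) - f (l k))) < e"
  shows "abs_cont_on a b f"
  unfolding abs_cont_on_def imp_conjL by (intro allI impI assms)

text \<open>Comparing increments replaces closure rules for sums and compositions: with
  \<open>f\<close> the horizontal curve it covers the planar projection and the defining function
  along the curve, with \<open>f\<close> the identity it covers Lipschitz functions.\<close>

lemma abs_cont_on_compose:
  fixes f :: "real \<Rightarrow> 'a::real_normed_vector" and g :: "real \<Rightarrow> 'b::real_normed_vector"
  assumes f: "abs_cont_on a b f"
    and bnd: "\<And>u v. u \<in> {a..b} \<Longrightarrow> v \<in> {a..b} \<Longrightarrow> norm (g v - g u) \<le> K * norm (f v - f u)"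
  shows "abs_cont_on a b g"
proof (rule abs_cont_onI)
  fix e :: real assume "e > 0"
  define K' where "K' = max K 1"
  have "K' > 0" "K \<le> K'" by (auto simp: K'_def)
  then have "e / K' > 0" using \<open>e > 0\<close> by simp
  then obtain d where "d > 0" and d: "\<And>(n::nat) l r. \<lbrakk>\<And>k. k < n \<Longrightarrow> a \<le> l k \<and> l k \<le> r k \<and> r k \<le> b;
        \<And>i j. \<lbrakk>i < n; j < n; i \<noteq> j\<rbrakk> \<Longrightarrow> r i \<le> l j \<or> r j \<le> l i; (\<Sum>k<n. r k - l k) < d\<rbrakk> \<Longrightarrow>
        (\<Sum>k<n. norm (f (r k) - f (l k))) < e / K'"
    using abs_cont_onD[OF f \<open>e / K' > 0\<close>] by blast
  have "(\<Sum>k<n. norm (g (r k) - g (l k))) < e"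
    if A: "\<forall>k<n. a \<le> l k \<and> l k \<le> r k \<and> r k \<le> b"
      "\<forall>i<n. \<forall>j<n. i \<noteq> j \<longrightarrow> r i \<le> l j \<or> r j \<le> l i" "(\<Sum>k<n. r k - l k) < d" for n :: nat and l r
  proof -
    have "norm (g (r k) - g (l k)) \<le> K' * norm (f (r k) - f (l k))" if "k < n" for k
    proof -
      have "a \<le> l k" "l k \<le> r k" "r k \<le> b" using A(1) that by auto
      then have "norm (g (r k) - g (l k)) \<le> K * norm (f (r k) - f (l k))"
        by (intro bnd) auto
      also have "\<dots> \<le> K' * norm (f (r k) - f (l k))"
        using \<open>K \<le> K'\<close> by (intro mult_right_mono) auto
      finally show ?thesis .
    qed
    then have "(\<Sum>k<n. norm (g (r k) - g (l k))) \<le> K' * (\<Sum>k<n. norm (f (r k) - f (l k)))"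
      unfolding sum_distrib_left by (intro sum_mono) auto
    also have "\<dots> < K' * (e / K')"
      using d[of n l r] A \<open>K' > 0\<close> by (intro mult_strict_left_mono) auto
    finally show ?thesis using \<open>K' > 0\<close> by simp
  qed
  then show "\<exists>d>0. \<forall>(n::nat) l r. (\<forall>k<n. a \<le> l k \<and> l k \<le> r k \<and> r k \<le> b) \<longrightarrow>
        (\<forall>i<n. \<forall>j<n. i \<noteq> j \<longrightarrow> r i \<le> l j \<or> r j \<le> l i) \<longrightarrow> (\<Sum>k<n. r k - l k) < d \<longrightarrow>
        (\<Sum>k<n. norm (g (r k) - g (l k))) < e"
    using \<open>d > 0\<close> by blast
qed

lemma abs_cont_on_ident: "abs_cont_on a b (\<lambda>x::real. x)"
proof (rule abs_cont_onI)
  fix e :: real assume "e > 0"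
  have "(\<Sum>k<n. norm (r k - l k)) < e"
    if "\<forall>k<n. a \<le> l k \<and> l k \<le> r k \<and> r k \<le> b" "(\<Sum>k<n. r k - l k) < e"
    for n :: nat and l r :: "nat \<Rightarrow> real"
  proof -
    have "(\<Sum>k<n. norm (r k - l k)) = (\<Sum>k<n. r k - l k)"
      using that(1) by (intro sum.cong) auto
    then show ?thesis using that(2) by simp
  qed
  then show "\<exists>d>0. \<forall>(n::nat) (l::nat \<Rightarrow> real) r. (\<forall>k<n. a \<le> l k \<and> l k \<le> r k \<and> r k \<le> b) \<longrightarrow>
        (\<forall>i<n. \<forall>j<n. i \<noteq> j \<longrightarrow> r i \<le> l j \<or> r j \<le> l i) \<longrightarrow> (\<Sum>k<n. r k - l k) < d \<longrightarrow>
        (\<Sum>k<n. norm (r k - l k)) < e"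
    using \<open>e > 0\<close> by blast
qed

lemma lipschitz_on_imp_abs_cont_on:
  fixes f :: "real \<Rightarrow> 'a::real_normed_vector"
  assumes "\<And>u v. u \<in> {a..b} \<Longrightarrow> v \<in> {a..b} \<Longrightarrow> norm (f v - f u) \<le> K * \<bar>v - u\<bar>"
  shows "abs_cont_on a b f"
  by (rule abs_cont_on_compose[OF abs_cont_on_ident]) (use assms in auto)

lemma abs_cont_on_subset:
  assumes "abs_cont_on a b f" "a \<le> c" "d \<le> b"
  shows "abs_cont_on c d f"
proof (rule abs_cont_onI)
  fix e :: real assume "e > 0"
  then obtain \<delta> where "\<delta> > 0" and \<delta>: "\<And>(n::nat) l r. \<lbrakk>\<And>k. k < n \<Longrightarrow> a \<le> l k \<and> l k \<le> r k \<and> r k \<le> b;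
        \<And>i j. \<lbrakk>i < n; j < n; i \<noteq> j\<rbrakk> \<Longrightarrow> r i \<le> l j \<or> r j \<le> l i; (\<Sum>k<n. r k - l k) < \<delta>\<rbrakk> \<Longrightarrow>
        (\<Sum>k<n. norm (f (r k) - f (l k))) < e"
    using abs_cont_onD[OF assms(1) \<open>e > 0\<close>] by blast
  have "(\<Sum>k<n. norm (f (r k) - f (l k))) < e"
    if "\<forall>k<n. c \<le> l k \<and> l k \<le> r k \<and> r k \<le> d"
      "\<forall>i<n. \<forall>j<n. i \<noteq> j \<longrightarrow> r i \<le> l j \<or> r j \<le> l i" "(\<Sum>k<n. r k - l k) < \<delta>" for n :: nat and l r
    by (rule \<delta>) (use that assms(2,3) in \<open>auto intro: order_trans\<close>)
  then show "\<exists>\<delta>>0. \<forall>(n::nat) l r. (\<forall>k<n. c \<le> l k \<and> l k \<le> r k \<and> r k \<le> d) \<longrightarrow>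
        (\<forall>i<n. \<forall>j<n. i \<noteq> j \<longrightarrow> r i \<le> l j \<or> r j \<le> l i) \<longrightarrow> (\<Sum>k<n. r k - l k) < \<delta> \<longrightarrow>
        (\<Sum>k<n. norm (f (r k) - f (l k))) < e"
    using \<open>\<delta> > 0\<close> by blast
qed

text \<open>Tagged divisions are finite sets of pairs, while \<open>abs_cont_on\<close> numbers its
  intervals; a bijection with an initial segment of the naturals carries the estimate over.\<close>

lemma abs_cont_on_finite_family:
  fixes f :: "real \<Rightarrow> 'a::real_normed_vector"
  assumes "abs_cont_on a b f" "e > 0"
  shows "\<exists>d>0. \<forall>I (l :: 'i \<Rightarrow> real) r. finite I \<longrightarrow> (\<forall>i\<in>I. a \<le> l i \<and> l i \<le> r i \<and> r i \<le> b) \<longrightarrow>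
        (\<forall>i\<in>I. \<forall>j\<in>I. i \<noteq> j \<longrightarrow> r i \<le> l j \<or> r j \<le> l i) \<longrightarrow> (\<Sum>i\<in>I. r i - l i) < d
      \<longrightarrow> (\<Sum>i\<in>I. norm (f (r i) - f (l i))) < e"
proof -
  obtain d where "d > 0" and d: "\<And>(n::nat) l r. \<lbrakk>\<And>k. k < n \<Longrightarrow> a \<le> l k \<and> l k \<le> r k \<and> r k \<le> b;
        \<And>i j. \<lbrakk>i < n; j < n; i \<noteq> j\<rbrakk> \<Longrightarrow> r i \<le> l j \<or> r j \<le> l i; (\<Sum>k<n. r k - l k) < d\<rbrakk> \<Longrightarrow>
        (\<Sum>k<n. norm (f (r k) - f (l k))) < e"
    using abs_cont_onD[OF assms] by blast
  show ?thesis
  proof (intro exI[of _ d] conjI allI impI, rule \<open>d > 0\<close>)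
    fix I and l r :: "'i \<Rightarrow> real"
    assume I: "finite I" "\<forall>i\<in>I. a \<le> l i \<and> l i \<le> r i \<and> r i \<le> b"
      "\<forall>i\<in>I. \<forall>j\<in>I. i \<noteq> j \<longrightarrow> r i \<le> l j \<or> r j \<le> l i" "(\<Sum>i\<in>I. r i - l i) < d"
    obtain h where h: "bij_betw h {..<card I} I"
      using ex_bij_betw_nat_finite[OF \<open>finite I\<close>] by (auto simp: atLeast0LessThan)
    have hI: "h k \<in> I" if "k < card I" for k
      using h that by (auto simp: bij_betw_def)
    have hinj: "h i \<noteq> h j" if "i < card I" "j < card I" "i \<noteq> j" for i j
      using h that by (auto simp: bij_betw_def inj_on_def)
    have "(\<Sum>k<card I. norm (f (r (h k)) - f (l (h k)))) < e"
    proof (rule d)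
      show "(\<Sum>k<card I. r (h k) - l (h k)) < d"
        using I(4) sum.reindex_bij_betw[OF h, of "\<lambda>i. r i - l i"] by simp
    qed (use I hI hinj in auto)
    then show "(\<Sum>i\<in>I. norm (f (r i) - f (l i))) < e"
      using sum.reindex_bij_betw[OF h, of "\<lambda>i. norm (f (r i) - f (l i))"] by simp
  qed
qed

text \<open>Converts the disjoint interiors supplied by a tagged division into the ordering by which
  \<open>abs_cont_on\<close> expresses non-overlap. The empty interior of a degenerate interval
  would say nothing about its position.\<close>

lemma disjoint_open_intervals_ordered:
  fixes l1 r1 l2 r2 :: real
  assumes "l1 < r1" "l2 < r2" "{l1<..<r1} \<inter> {l2<..<r2} = {}"
  shows "r1 \<le> l2 \<or> r2 \<le> l1"
proof (rule ccontr)
  assume "\<not> ?thesis"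
  then have "max l1 l2 < min r1 r2" using assms by auto
  then obtain x where "max l1 l2 < x" "x < min r1 r2" using dense by blast
  then have "x \<in> {l1<..<r1} \<inter> {l2<..<r2}" by auto
  with assms(3) show False by blast
qed

text \<open>The closed intervals may share endpoints, but their interiors are disjoint and have the
  same lengths, so additivity and monotonicity of the measure apply to these.\<close>

lemma sum_interval_lengths_le_measure:
  fixes l r :: "'i \<Rightarrow> real"
  assumes "finite I" "\<And>i. i \<in> I \<Longrightarrow> l i \<le> r i \<and> {l i..r i} \<subseteq> U" "U \<in> lmeasurable"
    and ord: "\<And>i j. \<lbrakk>i \<in> I; j \<in> I; i \<noteq> j\<rbrakk> \<Longrightarrow> r i \<le> l j \<or> r j \<le> l i"
  shows "(\<Sum>i\<in>I. r i - l i) \<le> measure lebesgue U"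
proof -
  have "(\<Sum>i\<in>I. r i - l i) = (\<Sum>i\<in>I. measure lebesgue {l i<..<r i})"
    using assms(2) by (intro sum.cong) auto
  also have "\<dots> = measure lebesgue (\<Union>((\<lambda>i. {l i<..<r i}) ` I))"
  proof (rule measure_negligible_finite_Union_image[symmetric, OF assms(1)])
    show "pairwise (\<lambda>i j. negligible ({l i<..<r i} \<inter> {l j<..<r j})) I"
    proof (rule pairwiseI)
      fix i j assume "i \<in> I" "j \<in> I" "i \<noteq> j"
      then have "{l i<..<r i} \<inter> {l j<..<r j} = {}" using ord[of i j] by auto
      then show "negligible ({l i<..<r i} \<inter> {l j<..<r j})" by simp
    qed
  qed auto
  also have "\<dots> \<le> measure lebesgue U"
  proof (rule measure_mono_fmeasurable)
    show "\<Union>((\<lambda>i. {l i<..<r i}) ` I) \<subseteq> U"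
    proof (rule UN_least)
      fix i assume "i \<in> I"
      then have "{l i..r i} \<subseteq> U" using assms(2) by auto
      then show "{l i<..<r i} \<subseteq> U" by (auto simp: subset_eq)
    qed
    have "open (\<Union>((\<lambda>i. {l i<..<r i}) ` I))" by auto
    then show "\<Union>((\<lambda>i. {l i<..<r i}) ` I) \<in> sets lebesgue" by auto
  qed (use assms in auto)
  finally show ?thesis .
qed

lemma negligible_outer_open:
  fixes N :: "real set"
  assumes "negligible N" "d > 0"
  obtains U where "open U" "N \<subseteq> U" "U \<in> lmeasurable" "measure lebesgue U < d"
proof -
  have N: "N \<in> lmeasurable" using assms(1) by (rule negligible_imp_measurable)
  then have "N \<in> sets lebesgue" by (rule fmeasurableD)
  then obtain U where U: "open U" "N \<subseteq> U" "U - N \<in> lmeasurable" "emeasure lebesgue (U - N) < ennreal d"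
    using sets_lebesgue_outer_open[of N d] assms(2) by blast
  have "U = (U - N) \<union> N" using U(2) by auto
  then have "U \<in> lmeasurable" using U(3) N fmeasurable.Un by metis
  have "measure lebesgue (U - N) < d"
    using U(3,4) assms(2) by (simp add: emeasure_eq_measure2 ennreal_less_iff)
  moreover have "measure lebesgue (U - N) = measure lebesgue U"
    using assms(1) \<open>U \<in> lmeasurable\<close>
    by (intro measure_Diff_null_set) (auto simp: negligible_iff_null_sets)
  ultimately show thesis using that[OF U(1,2) \<open>U \<in> lmeasurable\<close>] by simp
qed

text \<open>On subintervals tagged in the exceptional null set the gauge forces the intervals into an open
  set of small measure, where absolute continuity controls the increments; on all others the straddle
  estimate applies as in the usual fundamental theorem of calculus.\<close>

theorem abs_cont_on_has_integral:
  fixes f :: "real \<Rightarrow> 'a::banach"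
  assumes "a \<le> b" and ac: "abs_cont_on a b f" and N: "negligible N"
    and deriv: "\<And>x. x \<in> {a..b} - N \<Longrightarrow> (f has_vector_derivative f' x) (at x within {a..b})"
  shows "(f' has_integral (f b - f a)) {a..b}"
proof -
  define g where "g x = (if x \<in> N then 0 else f' x)" for x
  have "(g has_integral (f b - f a)) {a..b}"
    unfolding has_integral_real
  proof (intro allI impI)
    fix e :: real assume "e > 0"
    \<comment> \<open>Half of \<open>e\<close> pays for the straddle estimates, the other half for
      the intervals tagged in \<open>N\<close>. The summand 1 keeps the denominator positive when
      \<open>a = b\<close>.\<close>
    define e' where "e' = e / (2 * (b - a + 1))"
    have "e' > 0" using \<open>e > 0\<close> \<open>a \<le> b\<close> by (simp add: e'_def)
    have e'_le: "e' * (b - a) \<le> e / 2"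
      using \<open>e > 0\<close> \<open>a \<le> b\<close> by (simp add: e'_def field_simps)
    obtain \<delta> where "\<delta> > 0" and \<delta>: "\<forall>I (l :: real \<times> real set \<Rightarrow> real) r. finite I \<longrightarrow>
        (\<forall>i\<in>I. a \<le> l i \<and> l i \<le> r i \<and> r i \<le> b) \<longrightarrow>
        (\<forall>i\<in>I. \<forall>j\<in>I. i \<noteq> j \<longrightarrow> r i \<le> l j \<or> r j \<le> l i) \<longrightarrow> (\<Sum>i\<in>I. r i - l i) < \<delta>
      \<longrightarrow> (\<Sum>i\<in>I. norm (f (r i) - f (l i))) < e / 2"
      using abs_cont_on_finite_family[OF ac half_gt_zero[OF \<open>e > 0\<close>]] by blast
    obtain U where U: "open U" "N \<subseteq> U" "U \<in> lmeasurable" "measure lebesgue U < \<delta>"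
      using negligible_outer_open[OF N \<open>\<delta> > 0\<close>] .
    have "\<exists>d>0. x \<in> {a..b} - N \<longrightarrow>
         (\<forall>y\<in>{a..b}. norm (y - x) < d \<longrightarrow> norm (f y - f x - (y - x) *\<^sub>R f' x) \<le> e' * norm (y - x))" for x
      using deriv[of x, unfolded has_vector_derivative_def has_derivative_within_alt] \<open>e' > 0\<close>
      by (cases "x \<in> {a..b} - N") (blast intro: zero_less_one)+
    then obtain d1 where d1: "\<And>x. 0 < d1 x"
      "\<And>x y. \<lbrakk>x \<in> {a..b} - N; y \<in> {a..b}; norm (y - x) < d1 x\<rbrakk>
                        \<Longrightarrow> norm (f y - f x - (y - x) *\<^sub>R f' x) \<le> e' * norm (y - x)"
      by metis
    have "\<exists>d>0. x \<in> N \<longrightarrow> ball x d \<subseteq> U" for x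
      using U(1,2) open_contains_ball[of U] by (metis subsetD zero_less_one)
    then obtain d2 where d2: "\<And>x. 0 < d2 x" "\<And>x. x \<in> N \<Longrightarrow> ball x (d2 x) \<subseteq> U"
      by metis
    define \<gamma> where "\<gamma> x = ball x (if x \<in> N then d2 x else d1 x)" for x
    have "gauge \<gamma>" unfolding \<gamma>_def using d1(1) d2(1) by (intro gauge_ball_dependent) auto
    moreover have "norm ((\<Sum>(x, K)\<in>p. measure lborel K *\<^sub>R g x) - (f b - f a)) < e"
      if p: "p tagged_division_of {a..b}" and fine: "\<gamma> fine p" for p
    proof -
      have finp: "finite p" using p by auto
      \<comment> \<open>Degenerate intervals are left out: their increment is zero, and
        \<open>disjoint_open_intervals_ordered\<close> needs proper intervals.\<close>
      define D where "D = {i \<in> p. fst i \<in> N \<and> Inf (snd i) < Sup (snd i)}"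
      have finD: "finite D" using finp by (simp add: D_def)
      have K: "K = {Inf K..Sup K}" "Inf K \<le> x" "x \<le> Sup K" "a \<le> Inf K" "Sup K \<le> b" "x \<in> {a..b}"
        "measure lborel K = Sup K - Inf K" "K \<subseteq> \<gamma> x"
        if "(x, K) \<in> p" for x K
      proof -
        obtain u v where uv: "K = cbox u v" using tagged_division_ofD(4)[OF p \<open>(x, K) \<in> p\<close>] by blast
        have xK: "x \<in> K" "K \<subseteq> {a..b}" using tagged_division_ofD(2,3)[OF p that] by auto
        then have "u \<le> v" "K = {u..v}" using uv by auto
        then have "Inf K = u" "Sup K = v" by auto
        then show "K = {Inf K..Sup K}" "Inf K \<le> x" "x \<le> Sup K" "a \<le> Inf K" "Sup K \<le> b" "x \<in> {a..b}"
          "measure lborel K = Sup K - Inf K"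
          using xK \<open>u \<le> v\<close> \<open>K = {u..v}\<close> by auto
        show "K \<subseteq> \<gamma> x" using fine that by (auto simp: fine_def)
      qed
      have ordD: "Sup (snd i) \<le> Inf (snd j) \<or> Sup (snd j) \<le> Inf (snd i)"
        if "i \<in> D" "j \<in> D" "i \<noteq> j" for i j
      proof -
        obtain x1 K1 x2 K2 where ij: "i = (x1, K1)" "j = (x2, K2)" by (metis prod.exhaust)
        have in_p: "(x1, K1) \<in> p" "(x2, K2) \<in> p" "(x1, K1) \<noteq> (x2, K2)" "Inf K1 < Sup K1" "Inf K2 < Sup K2"
          using that ij by (auto simp: D_def)
        have "interior K1 \<inter> interior K2 = {}"
          using tagged_division_ofD(5)[OF p in_p(1-3)] .
        moreover have "interior K1 = {Inf K1<..<Sup K1}" "interior K2 = {Inf K2<..<Sup K2}"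
          using K(1)[OF in_p(1)] K(1)[OF in_p(2)] interior_atLeastAtMost_real by metis+
        ultimately show ?thesis
          using disjoint_open_intervals_ordered in_p(4,5) ij by auto
      qed
      have smallD: "(\<Sum>i\<in>D. norm (f (Sup (snd i)) - f (Inf (snd i)))) < e / 2"
      proof (rule \<delta>[rule_format, OF finD _ ordD])
        show "a \<le> Inf (snd i) \<and> Inf (snd i) \<le> Sup (snd i) \<and> Sup (snd i) \<le> b" if "i \<in> D" for i
          using K(4,5)[of "fst i" "snd i"] that by (auto simp: D_def)
        have "(\<Sum>i\<in>D. Sup (snd i) - Inf (snd i)) \<le> measure lebesgue U"
        proof (rule sum_interval_lengths_le_measure[OF finD _ U(3) ordD])
          fix i assume "i \<in> D"
          then have i: "(fst i, snd i) \<in> p" "fst i \<in> N" "Inf (snd i) < Sup (snd i)"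
            by (auto simp: D_def)
          have "snd i \<subseteq> U" using K(8)[OF i(1)] d2(2)[OF i(2)] i(2) by (auto simp: \<gamma>_def)
          then show "Inf (snd i) \<le> Sup (snd i) \<and> {Inf (snd i)..Sup (snd i)} \<subseteq> U"
            using i(3) K(1)[OF i(1)] by simp
        qed
        then show "(\<Sum>i\<in>D. Sup (snd i) - Inf (snd i)) < \<delta>" using U(4) by linarith
      qed
      have bound: "norm (measure lborel K *\<^sub>R g x - (f (Sup K) - f (Inf K))) \<le>
          e' * (Sup K - Inf K) + (if (x, K) \<in> D then norm (f (Sup K) - f (Inf K)) else 0)"
        if xK: "(x, K) \<in> p" for x K
      proof -
        note k = K[OF xK]
        show ?thesis
        proof (cases "x \<in> N")
          case True
          then have "g x = 0" by (simp add: g_def)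
          moreover have "0 \<le> e' * (Sup K - Inf K)" using \<open>e' > 0\<close> k(2,3) by simp
          moreover have "Sup K = Inf K" if "(x, K) \<notin> D"
            using that True xK k(2,3) by (auto simp: D_def)
          ultimately show ?thesis by (auto simp: norm_minus_commute)
        next
          case False
          define u v where "u = Inf K" and "v = Sup K"
          have uv: "u \<le> x" "x \<le> v" "u \<in> {a..b}" "v \<in> {a..b}" using k(2-5) by (auto simp: u_def v_def)
          have "K = {u..v}" using k(1) by (simp only: u_def v_def)
          then have "u \<in> K" "v \<in> K" using uv by auto
          then have "u \<in> ball x (d1 x)" "v \<in> ball x (d1 x)" using k(8) False by (auto simp: \<gamma>_def)
          then have "norm (f u - f x - (u - x) *\<^sub>R f' x) \<le> e' * norm (u - x)"
            "norm (f v - f x - (v - x) *\<^sub>R f' x) \<le> e' * norm (v - x)"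
            using d1(2)[of x u] d1(2)[of x v] k(6) False uv by (auto simp: dist_real_def)
          moreover have "(v - u) *\<^sub>R f' x - (f v - f u) =
              (f u - f x - (u - x) *\<^sub>R f' x) - (f v - f x - (v - x) *\<^sub>R f' x)"
            by (simp add: algebra_simps)
          ultimately have "norm ((v - u) *\<^sub>R f' x - (f v - f u)) \<le> e' * norm (u - x) + e' * norm (v - x)"
            using norm_triangle_le_diff add_mono by metis
          also have "\<dots> = e' * (v - u)" using uv by (simp add: algebra_simps)
          finally show ?thesis using False k(7) \<open>e' > 0\<close> by (auto simp: g_def u_def v_def D_def)
        qed
      qed
      have tel: "f b - f a = (\<Sum>(x, K)\<in>p. f (Sup K) - f (Inf K))" "b - a = (\<Sum>(x, K)\<in>p. Sup K - Inf K)"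
        using additive_tagged_division_1[OF \<open>a \<le> b\<close> p, of f]
          additive_tagged_division_1[OF \<open>a \<le> b\<close> p, of "\<lambda>x. x"] by auto
      have "(\<Sum>(x, K)\<in>p. measure lborel K *\<^sub>R g x) - (f b - f a) =
          (\<Sum>(x, K)\<in>p. measure lborel K *\<^sub>R g x - (f (Sup K) - f (Inf K)))"
        unfolding tel(1) by (simp add: sum_subtractf[symmetric] case_prod_unfold)
      also have "norm \<dots> \<le> (\<Sum>(x, K)\<in>p. e' * (Sup K - Inf K) +
          (if (x, K) \<in> D then norm (f (Sup K) - f (Inf K)) else 0))"
        by (rule sum_norm_le) (use bound in auto)
      also have "\<dots> = e' * (b - a) + (\<Sum>i\<in>p. if i \<in> D then norm (f (Sup (snd i)) - f (Inf (snd i))) else 0)"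
        unfolding tel(2) by (simp add: sum.distrib sum_distrib_left case_prod_unfold)
      also have "(\<Sum>i\<in>p. if i \<in> D then norm (f (Sup (snd i)) - f (Inf (snd i))) else 0) =
          (\<Sum>i\<in>D. norm (f (Sup (snd i)) - f (Inf (snd i))))"
      proof -
        have "p \<inter> D = D" by (auto simp: D_def)
        then show ?thesis by (simp add: sum.inter_restrict[OF finp, symmetric])
      qed
      also have "e' * (b - a) + \<dots> < e" using e'_le smallD by linarith
      finally show ?thesis .
    qed
    ultimately show "\<exists>\<gamma>. gauge \<gamma> \<and> (\<forall>p. p tagged_division_of {a..b} \<and> \<gamma> fine p \<longrightarrow>
        norm ((\<Sum>(x, K)\<in>p. measure lborel K *\<^sub>R g x) - (f b - f a)) < e)"
      by (intro exI[of _ \<gamma>] conjI allI impI) auto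
  qed
  then show ?thesis
    by (rule has_integral_spike[OF N, rotated]) (auto simp: g_def)
qed

section \<open>Growth of the defining function along horizontal curves\<close>

text \<open>The fundamental theorem turns a bound on the derivative off a null set into a bound on
  the increment. Setting the derivative to zero on \<open>N\<close> makes the comparison with
  \<open>k\<close> hold at every point, which is where nonnegativity of \<open>k\<close>
  enters.\<close>

lemma abs_cont_on_norm_increment_le:
  fixes f :: "real \<Rightarrow> 'a::banach"
  assumes "a \<le> b" "abs_cont_on a b f" "negligible N"
    and "\<And>x. x \<in> {a..b} - N \<Longrightarrow> (f has_vector_derivative f' x) (at x within {a..b})"
    and "\<And>x. x \<in> {a..b} - N \<Longrightarrow> norm (f' x) \<le> k x"
    and "\<And>x. x \<in> {a..b} \<Longrightarrow> 0 \<le> k x" "(k has_integral I) {a..b}"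
  shows "norm (f b - f a) \<le> I"
proof -
  define g where "g x = (if x \<in> N then 0 else f' x)" for x
  have g: "(g has_integral (f b - f a)) {a..b}"
    by (rule abs_cont_on_has_integral[OF assms(1-3)]) (use assms(4) in \<open>auto simp: g_def\<close>)
  have "norm (integral {a..b} g) \<le> integral {a..b} k"
    by (rule Henstock_Kurzweil_Integration.integral_norm_bound_integral)
      (use g assms(5-7) in \<open>auto simp: g_def has_integral_integrable\<close>)
  then show ?thesis
    using integral_unique[OF g] integral_unique[OF assms(7)] by simp
qed

text \<open>The planar velocity is the control pair itself, so length is the Euclidean length of the
  projection, and the height obeys \<open>dt = |z|^(2m) (y dx - x dy)\<close>.\<close>

lemma horizontal_field_eq:
  "a *\<^sub>R Xf m p + b *\<^sub>R Yf m p =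
     ((a, b), norm (fst p) powr (2 * m) * (a * snd (fst p) - b * fst (fst p)))"
  by (cases p rule: prod.exhaust, cases "fst p") (auto simp: Xf_def Yf_def algebra_simps)

lemma frechet_derivative_eq_partials:
  assumes "g differentiable (at z)"
  shows "frechet_derivative g (at z) (h, k) = h * pd False g z + k * pd True g z"
proof -
  have "linear (frechet_derivative g (at z))"
    using assms by (rule linear_frechet_derivative)
  then have "frechet_derivative g (at z) (h *\<^sub>R (1, 0) + k *\<^sub>R (0, 1)) = h * pd False g z + k * pd True g z"
    by (simp add: pd_def linear_add linear_scale del: scaleR_Pair)
  then show ?thesis by simp
qed

text \<open>Bridges two integrals: length is an \<open>ennreal\<close>-valued Lebesgue integral,
  whereas the increment estimate wants a gauge integral over the unit interval. A length below a
  finite \<open>r\<close> supplies integrability.\<close>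

lemma curve_length_has_integral:
  assumes "\<alpha> \<in> borel_measurable lebesgue" "\<beta> \<in> borel_measurable lebesgue"
    and "curve_length \<alpha> \<beta> < ennreal r"
  obtains L where "L < r" "((\<lambda>s. norm (\<alpha> s, \<beta> s)) has_integral L) {0..1}"
proof -
  let ?l = "\<lambda>s. indicat_real {0..1} s *\<^sub>R norm (\<alpha> s, \<beta> s)"
  have meas: "?l \<in> borel_measurable lebesgue"
    using assms(1,2) by (intro borel_measurable_scaleR borel_measurable_indicator
      borel_measurable_norm borel_measurable_Pair) auto
  have eq: "curve_length \<alpha> \<beta> = (\<integral>\<^sup>+ s. ennreal (?l s) \<partial>lebesgue)"
    unfolding curve_length_def by (intro nn_integral_cong) (auto simp: indicator_def)
  have "integrable lebesgue ?l"
  proof (rule integrableI_bounded[OF meas])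
    have "(\<integral>\<^sup>+ s. ennreal (norm (?l s)) \<partial>lebesgue) = curve_length \<alpha> \<beta>"
      unfolding eq by (intro nn_integral_cong) (simp add: norm_Pair)
    also have "\<dots> < \<infinity>" using assms(3) by (metis ennreal_less_top infinity_ennreal_def order_less_trans)
    finally show "(\<integral>\<^sup>+ s. ennreal (norm (?l s)) \<partial>lebesgue) < \<infinity>" .
  qed
  then have int: "set_integrable lebesgue {0..1} (\<lambda>s. norm (\<alpha> s, \<beta> s))"
    unfolding set_integrable_def .
  let ?L = "LINT s:{0..1}|lebesgue. norm (\<alpha> s, \<beta> s)"
  have "curve_length \<alpha> \<beta> = ennreal ?L"
    unfolding eq set_lebesgue_integral_def
    by (rule nn_integral_eq_integral) (use int in \<open>auto simp: set_integrable_def\<close>)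
  then have "?L < r"
    using assms(3) by (metis ennreal_leI linorder_not_less)
  then show thesis
    using has_integral_set_lebesgue[OF int] that by blast
qed

text \<open>The defining function \<open>\<phi>(z) - t\<close> changes along a horizontal curve at rate at most
  \<open>|ZF|\<close> per unit length.\<close>

lemma cc_dist_less_defining_function_bound:
  assumes diff: "\<And>z. \<phi> differentiable (at z)"
    and lip: "\<And>R. \<exists>K. \<forall>u\<in>cball 0 R. \<forall>v\<in>cball 0 R. \<bar>\<phi> v - \<phi> u\<bar> \<le> K * norm (v - u)"
    and d: "cc_dist m p q < ennreal r"
    and M: "\<And>w. w \<in> cball (fst p) r \<Longrightarrow> norm (ZF m \<phi> w) \<le> M"
  shows "\<bar>(\<phi> (fst q) - snd q) - (\<phi> (fst p) - snd p)\<bar> \<le> M * r"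
proof -
  from d obtain \<gamma> \<alpha> \<beta> where hor: "horizontal m \<gamma> \<alpha> \<beta>" and ends: "\<gamma> 0 = p" "\<gamma> 1 = q"
    and len: "curve_length \<alpha> \<beta> < ennreal r"
    unfolding cc_dist_def INF_less_iff by blast
  obtain L where L: "L < r" "((\<lambda>s. norm (\<alpha> s, \<beta> s)) has_integral L) {0..1}"
    using curve_length_has_integral[OF _ _ len] hor unfolding horizontal_def by blast
  have ac: "abs_cont_on 0 1 \<gamma>" using hor unfolding horizontal_def by blast
  have "\<exists>N. negligible N \<and> {s. \<not> (s \<in> {0..1} \<longrightarrow>
        (\<gamma> has_vector_derivative (\<alpha> s *\<^sub>R Xf m (\<gamma> s) + \<beta> s *\<^sub>R Yf m (\<gamma> s))) (at s within {0..1}))} \<subseteq> N"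
    using hor unfolding horizontal_def eventually_ae_filter_negligible by blast
  then obtain N where N: "negligible N" and der: "\<And>s. s \<in> {0..1} - N \<Longrightarrow>
     (\<gamma> has_vector_derivative (\<alpha> s *\<^sub>R Xf m (\<gamma> s) + \<beta> s *\<^sub>R Yf m (\<gamma> s))) (at s within {0..1})"
    by blast
  define z where "z s = fst (\<gamma> s)" for s
  have ac_z: "abs_cont_on 0 1 z"
  proof (rule abs_cont_on_compose[OF ac])
    show "norm (z v - z u) \<le> 1 * norm (\<gamma> v - \<gamma> u)" for u v
      unfolding z_def by (metis fst_diff mult_1 norm_fst_le prod.collapse)
  qed
  have der_z: "(z has_vector_derivative (\<alpha> s, \<beta> s)) (at s within {0..1})" if "s \<in> {0..1} - N" for s
    using bounded_linear.has_vector_derivative[OF bounded_linear_fst der[OF that]]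
    unfolding z_def horizontal_field_eq by simp
  \<comment> \<open>The projection moves no farther than the length of the curve, so it stays where
    \<open>M\<close> bounds \<open>ZF\<close>. The same confinement makes the local estimate
    \<open>lip\<close> applicable to the whole curve.\<close>
  have z_in: "z s \<in> cball (fst p) r" if s: "s \<in> {0..1}" for s
  proof -
    have sub: "{0..s} \<subseteq> {0..1}" using s by auto
    have int_s: "(\<lambda>s. norm (\<alpha> s, \<beta> s)) integrable_on {0..s}"
      using integrable_on_subinterval[OF _ sub] L(2) by blast
    have "norm (z s - z 0) \<le> integral {0..s} (\<lambda>s. norm (\<alpha> s, \<beta> s))"
    proof (rule abs_cont_on_norm_increment_le[OF _ _ N])
      show "abs_cont_on 0 s z" using abs_cont_on_subset[OF ac_z] s by auto
      show "(z has_vector_derivative (\<alpha> x, \<beta> x)) (at x within {0..s})" if "x \<in> {0..s} - N" for x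
        by (rule has_vector_derivative_within_subset[OF der_z sub]) (use that sub in auto)
    qed (use s int_s in \<open>auto intro: integrable_integral\<close>)
    also have "\<dots> \<le> integral {0..1} (\<lambda>s. norm (\<alpha> s, \<beta> s))"
      by (rule integral_subset_le[OF sub int_s]) (use L(2) in auto)
    also have "\<dots> = L" using L(2) by (rule integral_unique)
    finally show ?thesis using L(1) ends by (simp add: z_def dist_norm norm_minus_commute)
  qed
  have "0 \<le> L" using has_integral_nonneg[OF L(2)] by simp
  then have "0 < r" using L(1) by simp
  then have "0 \<le> M" using M[of "fst p"] norm_ge_zero[of "ZF m \<phi> (fst p)"] by (metis centre_in_cball less_imp_le order_trans)
  define F where "F s = \<phi> (z s) - snd (\<gamma> s)" for s
  \<comment> \<open>The derivative of \<open>F\<close>: the height term combines with the gradient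
    of \<open>\<phi>\<close> into the inner product of \<open>ZF\<close> with the controls, ready
    for Cauchy-Schwarz.\<close>
  define F' where "F' s = \<alpha> s * XF m \<phi> (z s) + \<beta> s * YF m \<phi> (z s)" for s
  have ac_F: "abs_cont_on 0 1 F"
  proof -
    obtain K where K: "\<forall>u\<in>cball 0 (norm (fst p) + r). \<forall>v\<in>cball 0 (norm (fst p) + r). \<bar>\<phi> v - \<phi> u\<bar> \<le> K * norm (v - u)"
      using lip[of "norm (fst p) + r"] by (elim exE)
    show ?thesis
    proof (rule abs_cont_on_compose[OF ac])
      fix u v :: real assume uv: "u \<in> {0..1}" "v \<in> {0..1}"
      have "z s \<in> cball 0 (norm (fst p) + r)" if "s \<in> {0..1}" for s
        using z_in[OF that] norm_triangle_ineq2[of "z s" "fst p"] by (simp add: dist_norm norm_minus_commute)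
      then have "\<bar>\<phi> (z v) - \<phi> (z u)\<bar> \<le> K * norm (z v - z u)" using K uv by blast
      also have "\<dots> \<le> \<bar>K\<bar> * norm (z v - z u)" by (intro mult_right_mono) auto
      also have "\<dots> \<le> \<bar>K\<bar> * norm (\<gamma> v - \<gamma> u)"
        unfolding z_def by (intro mult_left_mono) (metis fst_diff norm_fst_le prod.collapse, simp)
      finally have "\<bar>\<phi> (z v) - \<phi> (z u)\<bar> \<le> \<bar>K\<bar> * norm (\<gamma> v - \<gamma> u)" .
      moreover have "\<bar>snd (\<gamma> v) - snd (\<gamma> u)\<bar> \<le> norm (\<gamma> v - \<gamma> u)"
        by (metis snd_diff norm_snd_le prod.collapse real_norm_def)
      ultimately show "norm (F v - F u) \<le> (\<bar>K\<bar> + 1) * norm (\<gamma> v - \<gamma> u)"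
        unfolding F_def real_norm_def distrib_right by linarith
    qed
  qed
  have der_F: "(F has_vector_derivative F' s) (at s within {0..1})" if s: "s \<in> {0..1} - N" for s
  proof -
    have "((\<lambda>s. \<phi> (z s)) has_derivative (\<lambda>h. frechet_derivative \<phi> (at (z s)) (h *\<^sub>R (\<alpha> s, \<beta> s)))) (at s within {0..1})"
      by (rule has_derivative_compose[OF der_z[OF s, unfolded has_vector_derivative_def]])
        (use diff frechet_derivative_works in blast)
    moreover have "linear (frechet_derivative \<phi> (at (z s)))"
      using diff by (rule linear_frechet_derivative)
    ultimately have 1: "((\<lambda>s. \<phi> (z s)) has_vector_derivative
        frechet_derivative \<phi> (at (z s)) (\<alpha> s, \<beta> s)) (at s within {0..1})"
      unfolding has_vector_derivative_def by (simp only: linear_scale)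
    have 2: "((\<lambda>s. snd (\<gamma> s)) has_vector_derivative
        norm (z s) powr (2 * m) * (\<alpha> s * snd (z s) - \<beta> s * fst (z s))) (at s within {0..1})"
      using bounded_linear.has_vector_derivative[OF bounded_linear_snd der[OF s]]
      unfolding z_def horizontal_field_eq by simp
    have "F' s = frechet_derivative \<phi> (at (z s)) (\<alpha> s, \<beta> s) -
        norm (z s) powr (2 * m) * (\<alpha> s * snd (z s) - \<beta> s * fst (z s))"
      unfolding F'_def frechet_derivative_eq_partials[OF diff] XF_def YF_def by (simp add: algebra_simps)
    then show ?thesis
      unfolding F_def using has_vector_derivative_diff[OF 1 2] by simp
  qed
  have "norm (F 1 - F 0) \<le> M * L"
  proof (rule abs_cont_on_norm_increment_le[OF _ ac_F N der_F])
    show "norm (F' s) \<le> M * norm (\<alpha> s, \<beta> s)" if "s \<in> {0..1} - N" for s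
    proof -
      have "F' s = inner (ZF m \<phi> (z s)) (\<alpha> s, \<beta> s)"
        by (simp add: F'_def ZF_def algebra_simps)
      then have "norm (F' s) \<le> norm (ZF m \<phi> (z s)) * norm (\<alpha> s, \<beta> s)"
        by (simp only: real_norm_def Cauchy_Schwarz_ineq2)
      also have "\<dots> \<le> M * norm (\<alpha> s, \<beta> s)"
        using M z_in that by (intro mult_right_mono) auto
      finally show ?thesis .
    qed
    show "((\<lambda>s. M * norm (\<alpha> s, \<beta> s)) has_integral M * L) {0..1}"
      using L(2) by (rule has_integral_mult_right)
  qed (use \<open>0 \<le> M\<close> in auto)
  also have "\<dots> \<le> M * r" using L(1) \<open>0 \<le> M\<close> by (intro mult_left_mono) auto
  finally show ?thesis unfolding F_def z_def ends by simp
qed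

section \<open>Explicit horizontal curves\<close>

text \<open>Curves over \<open>[0, T]\<close> of speed at most 1, differentiable off a finite set: unlike general
  horizontal curves these can be concatenated and reversed by mere translation and reflection of time.\<close>

definition reach :: "real \<Rightarrow> pt \<Rightarrow> pt \<Rightarrow> real \<Rightarrow> bool" where
  "reach m p q T \<longleftrightarrow> 0 \<le> T \<and> (\<exists>\<gamma> \<alpha> \<beta> S. \<gamma> 0 = p \<and> \<gamma> T = q \<and> continuous_on {0..T} \<gamma> \<and>
     \<alpha> \<in> borel_measurable borel \<and> \<beta> \<in> borel_measurable borel \<and> (\<forall>s. norm (\<alpha> s, \<beta> s) \<le> 1) \<and>
     finite S \<and> (\<forall>s\<in>{0<..<T} - S.
        (\<gamma> has_vector_derivative (\<alpha> s *\<^sub>R Xf m (\<gamma> s) + \<beta> s *\<^sub>R Yf m (\<gamma> s))) (at s)))"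

text \<open>On a bounded set the velocity is bounded; this makes the explicit curves Lipschitz,
  hence absolutely continuous as \<open>horizontal\<close> demands.\<close>

lemma norm_horizontal_field_le:
  assumes "0 \<le> m" "norm (a, b) \<le> T" "norm (fst p) \<le> R"
  shows "norm (a *\<^sub>R Xf m p + b *\<^sub>R Yf m p) \<le> T + R powr (2 * m) * (2 * T * R)"
proof -
  obtain x y t where p: "p = ((x, y), t)" by (metis prod.exhaust)
  have "\<bar>a\<bar> \<le> T" "\<bar>b\<bar> \<le> T"
    using assms(2) norm_fst_le[of a b] norm_snd_le[of b a] by auto
  moreover have xy: "\<bar>x\<bar> \<le> R" "\<bar>y\<bar> \<le> R" 
    using assms(3) norm_fst_le[of x y] norm_snd_le[of y x] by (auto simp: p)
  ultimately have "\<bar>a * y\<bar> \<le> T * R" "\<bar>b * x\<bar> \<le> T * R"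
    unfolding abs_mult by (auto intro!: mult_mono)
  then have "\<bar>a * y - b * x\<bar> \<le> 2 * T * R" by linarith
  moreover have "norm (x, y) powr (2 * m) \<le> R powr (2 * m)"
    using assms(1,3) by (intro powr_mono2) (auto simp: p)
  ultimately have "\<bar>norm (x, y) powr (2 * m) * (a * y - b * x)\<bar> \<le> R powr (2 * m) * (2 * T * R)"
    unfolding abs_mult by (intro mult_mono) auto
  then show ?thesis
    using assms(2) norm_Pair_le[of "(a, b)" "norm (x, y) powr (2 * m) * (a * y - b * x)"]
    unfolding horizontal_field_eq p by (simp only: fst_conv snd_conv real_norm_def)
qed

text \<open>Rescaling time to the unit interval multiplies the controls by \<open>T\<close>, so
  speed at most 1 becomes length at most \<open>T\<close>.\<close>

lemma reach_imp_cc_dist_le: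
  assumes "0 \<le> m" "reach m p q T"
  shows "cc_dist m p q \<le> ennreal T"
proof -
  obtain \<gamma> \<alpha> \<beta> S where "0 \<le> T" and ends: "\<gamma> 0 = p" "\<gamma> T = q" and cont: "continuous_on {0..T} \<gamma>"
    and meas[measurable]: "\<alpha> \<in> borel_measurable borel" "\<beta> \<in> borel_measurable borel"
    and ub: "\<And>s. norm (\<alpha> s, \<beta> s) \<le> 1" and "finite S"
    and der: "\<And>s. s \<in> {0<..<T} - S \<Longrightarrow>
        (\<gamma> has_vector_derivative (\<alpha> s *\<^sub>R Xf m (\<gamma> s) + \<beta> s *\<^sub>R Yf m (\<gamma> s))) (at s)"
    using assms(2) unfolding reach_def by blast
  define g a b where "g s = \<gamma> (T * s)" and "a s = T * \<alpha> (T * s)" and "b s = T * \<beta> (T * s)" for s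
  \<comment> \<open>The endpoints join the exceptional set because \<open>reach\<close> supplies
    derivatives in the open interval only.\<close>
  define S' where "S' = {0, 1} \<union> (\<lambda>x. x / T) ` S"
  have "finite S'" using \<open>finite S\<close> by (simp add: S'_def)
  have field: "T *\<^sub>R (\<alpha> (T * s) *\<^sub>R Xf m (g s) + \<beta> (T * s) *\<^sub>R Yf m (g s)) = a s *\<^sub>R Xf m (g s) + b s *\<^sub>R Yf m (g s)" for s
    by (simp add: a_def b_def scaleR_add_right)
  have der_g: "(g has_vector_derivative (a s *\<^sub>R Xf m (g s) + b s *\<^sub>R Yf m (g s))) (at s)"
    if s: "s \<in> {0<..<1} - S'" for s
  proof (cases "T = 0")
    case True
    then have "g = (\<lambda>_. \<gamma> 0)" by (auto simp: g_def)
    then show ?thesis using True by (simp add: a_def b_def)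
  next
    case False
    then have "T > 0" using \<open>0 \<le> T\<close> by simp
    have "T * s \<notin> S" using s False by (auto simp: S'_def image_iff)
    moreover have "T * s \<in> {0<..<T}" using s \<open>T > 0\<close> by auto
    ultimately have "(\<gamma> has_vector_derivative (\<alpha> (T * s) *\<^sub>R Xf m (g s) + \<beta> (T * s) *\<^sub>R Yf m (g s))) (at (T * s))"
      using der unfolding g_def by blast
    moreover have "((\<lambda>s. T * s) has_vector_derivative T) (at s)"
      by (auto intro!: derivative_eq_intros)
    ultimately have "(\<gamma> \<circ> (\<lambda>s. T * s) has_vector_derivative
        T *\<^sub>R (\<alpha> (T * s) *\<^sub>R Xf m (g s) + \<beta> (T * s) *\<^sub>R Yf m (g s))) (at s)"
      by (intro vector_diff_chain_at)
    moreover have "\<gamma> \<circ> (\<lambda>s. T * s) = g" by (auto simp: g_def)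
    ultimately show ?thesis unfolding field by simp
  qed
  have img: "(\<lambda>s. T * s) ` {0..1} \<subseteq> {0..T}"
    using \<open>0 \<le> T\<close> by (auto simp: mult_left_le)
  have cont_g: "continuous_on {0..1} g"
    unfolding g_def by (rule continuous_on_compose2[OF cont _ img]) (intro continuous_intros)
  have "compact (g ` {0..1})" using cont_g by (intro compact_continuous_image) auto
  then obtain R where "\<And>s. s \<in> {0..1} \<Longrightarrow> norm (g s) \<le> R"
    by (metis bounded_iff compact_imp_bounded image_eqI)
  then have R: "norm (fst (g s)) \<le> R" if "s \<in> {0..1}" for s
    using that norm_fst_le by (metis order_trans prod.collapse)
  have ab: "norm (a s, b s) \<le> T" for s
  proof -
    have "(a s, b s) = T *\<^sub>R (\<alpha> (T * s), \<beta> (T * s))" by (simp add: a_def b_def)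
    then have "norm (a s, b s) = T * norm (\<alpha> (T * s), \<beta> (T * s))"
      using \<open>0 \<le> T\<close> by (simp only: norm_scaleR abs_of_nonneg)
    also have "\<dots> \<le> T" using ub[of "T * s"] \<open>0 \<le> T\<close> by (simp add: mult_left_le)
    finally show ?thesis .
  qed
  define B where "B = T + R powr (2 * m) * (2 * T * R)"
  have lip_le: "norm (g v - g u) \<le> B * \<bar>v - u\<bar>" if uv: "u \<in> {0..1}" "v \<in> {0..1}" "u \<le> v" for u v
  proof -
    have sub: "{u..v} \<subseteq> {0..1}" using uv by auto
    have "((\<lambda>s. a s *\<^sub>R Xf m (g s) + b s *\<^sub>R Yf m (g s)) has_integral (g v - g u)) {u..v}"
      using uv sub
      by (intro fundamental_theorem_of_calculus_interior_strong[OF \<open>finite S'\<close>] der_g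
          continuous_on_subset[OF cont_g]) auto
    then have "norm (g v - g u) \<le> B * measure lborel (cbox u v)"
    proof (intro has_integral_bound)
      fix x assume "x \<in> cbox u v"
      then have "x \<in> {0..1}" using sub by auto
      then show "norm (a x *\<^sub>R Xf m (g x) + b x *\<^sub>R Yf m (g x)) \<le> B"
        unfolding B_def using norm_horizontal_field_le[OF assms(1) ab R] by blast
    next
      have "0 \<le> R" using R[OF uv(1)] norm_ge_zero order_trans by blast
      then show "0 \<le> B" using \<open>0 \<le> T\<close> by (simp add: B_def)
    qed (auto simp: box_real)
    then show ?thesis using uv(3) by simp
  qed
  have lip: "norm (g v - g u) \<le> B * \<bar>v - u\<bar>" if "u \<in> {0..1}" "v \<in> {0..1}" for u v
    using lip_le[of u v] lip_le[of v u] that by (cases "u \<le> v") (auto simp: norm_minus_commute abs_minus_commute)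
  have "horizontal m g a b"
    unfolding horizontal_def
  proof (intro conjI)
    show "abs_cont_on 0 1 g" using lip by (rule lipschitz_on_imp_abs_cont_on)
    show "a \<in> borel_measurable lebesgue" "b \<in> borel_measurable lebesgue"
      unfolding a_def b_def by (intro measurable_completion; measurable)+
    show "AE s in lebesgue. s \<in> {0..1} \<longrightarrow>
        (g has_vector_derivative (a s *\<^sub>R Xf m (g s) + b s *\<^sub>R Yf m (g s))) (at s within {0..1})"
      unfolding eventually_ae_filter_negligible
    proof (intro exI conjI)
      show "negligible S'" using \<open>finite S'\<close> by (rule negligible_finite)
      have "(g has_vector_derivative (a s *\<^sub>R Xf m (g s) + b s *\<^sub>R Yf m (g s))) (at s within {0..1})"
        if "s \<in> {0..1}" "s \<notin> S'" for s
        by (rule has_vector_derivative_at_within, rule der_g) (use that in \<open>auto simp: S'_def less_le\<close>)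
      then show "{s. \<not> (s \<in> {0..1} \<longrightarrow> (g has_vector_derivative
          (a s *\<^sub>R Xf m (g s) + b s *\<^sub>R Yf m (g s))) (at s within {0..1}))} \<subseteq> S'"
        by blast
    qed
  qed
  moreover have "g 0 = p" "g 1 = q" using ends by (auto simp: g_def)
  ultimately have "cc_dist m p q \<le> curve_length a b"
    unfolding cc_dist_def by (intro INF_lower) blast
  also have "\<dots> \<le> (\<integral>\<^sup>+ s. ennreal T * indicator {0..1::real} s \<partial>lebesgue)"
    unfolding curve_length_def
    by (rule nn_integral_mono) (auto simp: indicator_def intro: ennreal_leI ab)
  also have "\<dots> = ennreal T"
    by (subst nn_integral_cmult_indicator) auto
  finally show ?thesis .
qed

lemma reach_sym:
  assumes "reach m p q T"
  shows "reach m q p T"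
proof -
  obtain \<gamma> \<alpha> \<beta> S where "0 \<le> T" and ends: "\<gamma> 0 = p" "\<gamma> T = q" and cont: "continuous_on {0..T} \<gamma>"
    and meas[measurable]: "\<alpha> \<in> borel_measurable borel" "\<beta> \<in> borel_measurable borel"
    and ub: "\<And>s. norm (\<alpha> s, \<beta> s) \<le> 1" and "finite S"
    and der: "\<And>s. s \<in> {0<..<T} - S \<Longrightarrow>
        (\<gamma> has_vector_derivative (\<alpha> s *\<^sub>R Xf m (\<gamma> s) + \<beta> s *\<^sub>R Yf m (\<gamma> s))) (at s)"
    using assms unfolding reach_def by blast
  define g a b where "g s = \<gamma> (T - s)" and "a s = - \<alpha> (T - s)" and "b s = - \<beta> (T - s)" for s
  have "continuous_on {0..T} g"
    unfolding g_def by (rule continuous_on_compose2[OF cont]) (auto intro!: continuous_intros)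
  moreover have "a \<in> borel_measurable borel" "b \<in> borel_measurable borel"
    unfolding a_def b_def by measurable
  moreover have "norm (a s, b s) \<le> 1" for s
    using ub[of "T - s"] by (simp add: a_def b_def norm_Pair)
  moreover have "finite ((\<lambda>x. T - x) ` S)" using \<open>finite S\<close> by simp
  moreover have "(g has_vector_derivative (a s *\<^sub>R Xf m (g s) + b s *\<^sub>R Yf m (g s))) (at s)"
    if s: "s \<in> {0<..<T} - (\<lambda>x. T - x) ` S" for s
  proof -
    have "T - s \<notin> S" using s by (auto simp: image_iff)
    then have "(\<gamma> has_vector_derivative (\<alpha> (T - s) *\<^sub>R Xf m (g s) + \<beta> (T - s) *\<^sub>R Yf m (g s))) (at (T - s))"
      using s der[of "T - s"] unfolding g_def by auto
    moreover have "((\<lambda>s. T - s) has_vector_derivative (-1)) (at s)"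
      by (auto intro!: derivative_eq_intros)
    ultimately have "(\<gamma> \<circ> (\<lambda>s. T - s) has_vector_derivative
        (-1) *\<^sub>R (\<alpha> (T - s) *\<^sub>R Xf m (g s) + \<beta> (T - s) *\<^sub>R Yf m (g s))) (at s)"
      by (intro vector_diff_chain_at)
    moreover have "\<gamma> \<circ> (\<lambda>s. T - s) = g" by (auto simp: g_def)
    ultimately show ?thesis by (simp add: a_def b_def)
  qed
  moreover have "g 0 = q" "g T = p" using ends by (auto simp: g_def)
  ultimately show ?thesis unfolding reach_def using \<open>0 \<le> T\<close> by blast
qed

lemma reach_trans:
  assumes "reach m p q T1" "reach m q r T2"
  shows "reach m p r (T1 + T2)"
proof -
  obtain \<gamma>1 \<alpha>1 \<beta>1 S1 where "0 \<le> T1" and ends1: "\<gamma>1 0 = p" "\<gamma>1 T1 = q" and cont1: "continuous_on {0..T1} \<gamma>1"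
    and meas1[measurable]: "\<alpha>1 \<in> borel_measurable borel" "\<beta>1 \<in> borel_measurable borel"
    and ub1: "\<And>s. norm (\<alpha>1 s, \<beta>1 s) \<le> 1" and "finite S1"
    and der1: "\<And>s. s \<in> {0<..<T1} - S1 \<Longrightarrow>
        (\<gamma>1 has_vector_derivative (\<alpha>1 s *\<^sub>R Xf m (\<gamma>1 s) + \<beta>1 s *\<^sub>R Yf m (\<gamma>1 s))) (at s)"
    using assms(1) unfolding reach_def by blast
  obtain \<gamma>2 \<alpha>2 \<beta>2 S2 where "0 \<le> T2" and ends2: "\<gamma>2 0 = q" "\<gamma>2 T2 = r" and cont2: "continuous_on {0..T2} \<gamma>2"
    and meas2[measurable]: "\<alpha>2 \<in> borel_measurable borel" "\<beta>2 \<in> borel_measurable borel"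
    and ub2: "\<And>s. norm (\<alpha>2 s, \<beta>2 s) \<le> 1" and "finite S2"
    and der2: "\<And>s. s \<in> {0<..<T2} - S2 \<Longrightarrow>
        (\<gamma>2 has_vector_derivative (\<alpha>2 s *\<^sub>R Xf m (\<gamma>2 s) + \<beta>2 s *\<^sub>R Yf m (\<gamma>2 s))) (at s)"
    using assms(2) unfolding reach_def by blast
  define g where "g s = (if s \<le> T1 then \<gamma>1 s else \<gamma>2 (s - T1))" for s
  define a where "a s = (if s \<le> T1 then \<alpha>1 s else \<alpha>2 (s - T1))" for s
  define b where "b s = (if s \<le> T1 then \<beta>1 s else \<beta>2 (s - T1))" for s
  \<comment> \<open>The glued curve may have a corner at the junction \<open>T1\<close>.\<close>
  define S where "S = insert T1 (S1 \<union> (\<lambda>x. T1 + x) ` S2)"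
  have "continuous_on ({0..T1} \<union> {T1..T1+T2}) g"
    unfolding g_def
  proof (rule continuous_on_cases)
    show "continuous_on {T1..T1+T2} (\<lambda>s. \<gamma>2 (s - T1))"
      by (rule continuous_on_compose2[OF cont2]) (auto intro!: continuous_intros)
    show "\<forall>x. x \<in> {0..T1} \<and> \<not> x \<le> T1 \<or> x \<in> {T1..T1+T2} \<and> x \<le> T1 \<longrightarrow> \<gamma>1 x = \<gamma>2 (x - T1)"
      using ends1 ends2 by auto
  qed (use cont1 in auto)
  moreover have "{0..T1} \<union> {T1..T1+T2} = {0..T1+T2}" using \<open>0 \<le> T1\<close> \<open>0 \<le> T2\<close> by auto
  ultimately have "continuous_on {0..T1+T2} g" by simp
  moreover have "a \<in> borel_measurable borel" "b \<in> borel_measurable borel"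
    unfolding a_def b_def by measurable
  moreover have "norm (a s, b s) \<le> 1" for s
    using ub1 ub2 by (simp add: a_def b_def)
  moreover have "finite S" using \<open>finite S1\<close> \<open>finite S2\<close> by (simp add: S_def)
  moreover have "(g has_vector_derivative (a s *\<^sub>R Xf m (g s) + b s *\<^sub>R Yf m (g s))) (at s)"
    if s: "s \<in> {0<..<T1+T2} - S" for s
  proof (cases "s < T1")
    case True
    then have "(\<gamma>1 has_vector_derivative (a s *\<^sub>R Xf m (g s) + b s *\<^sub>R Yf m (g s))) (at s)"
      using der1[of s] s by (auto simp: S_def a_def b_def g_def)
    then show ?thesis
      by (rule has_vector_derivative_transform_within_open[where S = "{..<T1}"]) (use True in \<open>auto simp: g_def\<close>)
  next
    case False
    then have "s > T1" using s by (auto simp: S_def)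
    have "s - T1 \<notin> S2" using s by (auto simp: S_def image_iff)
    then have "(\<gamma>2 has_vector_derivative (a s *\<^sub>R Xf m (g s) + b s *\<^sub>R Yf m (g s))) (at (s - T1))"
      using der2[of "s - T1"] s \<open>s > T1\<close> by (auto simp: a_def b_def g_def)
    moreover have "((\<lambda>s. s - T1) has_vector_derivative 1) (at s)"
      by (auto intro!: derivative_eq_intros)
    ultimately have "(\<gamma>2 \<circ> (\<lambda>s. s - T1) has_vector_derivative
        1 *\<^sub>R (a s *\<^sub>R Xf m (g s) + b s *\<^sub>R Yf m (g s))) (at s)"
      by (intro vector_diff_chain_at)
    then show ?thesis unfolding scaleR_one
      by (rule has_vector_derivative_transform_within_open[where S = "{T1<..}"]) (use \<open>s > T1\<close> in \<open>auto simp: g_def\<close>)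
  qed
  moreover have "g 0 = p" "g (T1 + T2) = r"
    using ends1 ends2 \<open>0 \<le> T1\<close> \<open>0 \<le> T2\<close> by (auto simp: g_def)
  ultimately show ?thesis unfolding reach_def using \<open>0 \<le> T1\<close> \<open>0 \<le> T2\<close>
    by (intro conjI exI[of _ g] exI[of _ a] exI[of _ b] exI[of _ S]) auto
qed

section \<open>Rays, arcs, vertical segments and flow lines\<close>

lemma has_vector_derivative_Pair_Pair:
  assumes "(f has_real_derivative f') (at s)" "(g has_real_derivative g') (at s)"
    "(h has_real_derivative h') (at s)"
  shows "((\<lambda>s. ((f s, g s), h s)) has_vector_derivative ((f', g'), h')) (at s)"
  using assms unfolding has_real_derivative_iff_has_vector_derivative
  by (intro has_vector_derivative_Pair)

lemma reachI:
  assumes "0 \<le> T" "\<gamma> 0 = p" "\<gamma> T = q" "continuous_on {0..T} \<gamma>"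
    and "\<alpha> \<in> borel_measurable borel" "\<beta> \<in> borel_measurable borel" "\<And>s. norm (\<alpha> s, \<beta> s) \<le> 1"
    and "\<And>s. s \<in> {0<..<T} \<Longrightarrow>
        (\<gamma> has_vector_derivative (\<alpha> s *\<^sub>R Xf m (\<gamma> s) + \<beta> s *\<^sub>R Yf m (\<gamma> s))) (at s)"
  shows "reach m p q T"
  unfolding reach_def using assms
  by (intro conjI exI[of _ \<gamma>] exI[of _ \<alpha>] exI[of _ \<beta>] exI[of _ "{}"]) auto

text \<open>Along a ray the velocity is parallel to the position, so \<open>y dx - x dy\<close>
  vanishes and the height stays constant.\<close>

lemma reach_radial:
  assumes "0 \<le> \<rho>"
  shows "reach m ((r * cos \<theta>, r * sin \<theta>), t) (((r + \<rho>) * cos \<theta>, (r + \<rho>) * sin \<theta>), t) \<rho>"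
proof (rule reachI[where \<gamma> = "\<lambda>s. (((r + s) * cos \<theta>, (r + s) * sin \<theta>), t)"
      and \<alpha> = "\<lambda>_. cos \<theta>" and \<beta> = "\<lambda>_. sin \<theta>"])
  fix s
  show "norm (cos \<theta>, sin \<theta>) \<le> 1" by (simp add: norm_Pair)
  have "((\<lambda>s. (((r + s) * cos \<theta>, (r + s) * sin \<theta>), t)) has_vector_derivative ((cos \<theta>, sin \<theta>), 0)) (at s)"
    by (rule has_vector_derivative_Pair_Pair) (auto intro!: derivative_eq_intros)
  then show "((\<lambda>s. (((r + s) * cos \<theta>, (r + s) * sin \<theta>), t)) has_vector_derivative
       cos \<theta> *\<^sub>R Xf m (((r + s) * cos \<theta>, (r + s) * sin \<theta>), t) +
       sin \<theta> *\<^sub>R Yf m (((r + s) * cos \<theta>, (r + s) * sin \<theta>), t)) (at s)"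
    unfolding horizontal_field_eq by simp
qed (use assms in \<open>auto intro!: continuous_intros\<close>)

text \<open>For clockwise motion at unit speed \<open>y dx - x dy = R ds\<close>, so the height
  grows at rate \<open>R^(2m+1)\<close> over the length \<open>R * \<psi>\<close>. The angle may
  exceed a full turn.\<close>

lemma reach_arc:
  assumes "0 < R" "0 \<le> \<psi>"
  shows "reach m ((R * cos \<theta>, R * sin \<theta>), t)
    ((R * cos (\<theta> - \<psi>), R * sin (\<theta> - \<psi>)), t + R powr (2 * m + 2) * \<psi>) (R * \<psi>)"
proof (rule reachI[where \<gamma> = "\<lambda>s. ((R * cos (\<theta> - s / R), R * sin (\<theta> - s / R)), t + R powr (2 * m + 1) * s)"
      and \<alpha> = "\<lambda>s. sin (\<theta> - s / R)" and \<beta> = "\<lambda>s. - cos (\<theta> - s / R)"])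
  let ?\<gamma> = "\<lambda>s. ((R * cos (\<theta> - s / R), R * sin (\<theta> - s / R)), t + R powr (2 * m + 1) * s)"
  have "R powr (2 * m + 2) = R powr (2 * m + 1) * R"
    using \<open>0 < R\<close> powr_add[of R "2 * m + 1" 1] by (simp add: add.assoc)
  then show "?\<gamma> (R * \<psi>) = ((R * cos (\<theta> - \<psi>), R * sin (\<theta> - \<psi>)), t + R powr (2 * m + 2) * \<psi>)"
    using \<open>0 < R\<close> by simp
  fix s
  show "norm (sin (\<theta> - s / R), - cos (\<theta> - s / R)) \<le> 1" by (simp add: norm_Pair)
  have "(?\<gamma> has_vector_derivative ((sin (\<theta> - s / R), - cos (\<theta> - s / R)), R powr (2 * m + 1))) (at s)"
    using \<open>0 < R\<close> by (intro has_vector_derivative_Pair_Pair) (auto intro!: derivative_eq_intros)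
  moreover have "norm (R * cos (\<theta> - s / R), R * sin (\<theta> - s / R)) = R"
  proof -
    have "(R * cos (\<theta> - s / R))\<^sup>2 + (R * sin (\<theta> - s / R))\<^sup>2 = R\<^sup>2 * ((cos (\<theta> - s / R))\<^sup>2 + (sin (\<theta> - s / R))\<^sup>2)"
      by (simp only: power_mult_distrib distrib_left)
    then show ?thesis using \<open>0 < R\<close> by (simp add: norm_Pair)
  qed
  moreover have "R powr (2 * m) * (sin (\<theta> - s / R) * (R * sin (\<theta> - s / R)) - - cos (\<theta> - s / R) * (R * cos (\<theta> - s / R)))
      = R powr (2 * m + 1)"
  proof -
    have "sin (\<theta> - s / R) * (R * sin (\<theta> - s / R)) - - cos (\<theta> - s / R) * (R * cos (\<theta> - s / R))
        = R * ((sin (\<theta> - s / R))\<^sup>2 + (cos (\<theta> - s / R))\<^sup>2)"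
      by algebra
    also have "\<dots> = R" by (simp only: sin_cos_squared_add mult_1_right)
    finally show ?thesis using \<open>0 < R\<close> powr_add[of R "2 * m" 1] by (simp only: powr_one)
  qed
  ultimately show "(?\<gamma> has_vector_derivative
       sin (\<theta> - s / R) *\<^sub>R Xf m (?\<gamma> s) + (- cos (\<theta> - s / R)) *\<^sub>R Yf m (?\<gamma> s)) (at s)"
    unfolding horizontal_field_eq fst_conv snd_conv by simp
qed (use assms in \<open>auto intro!: continuous_intros\<close>)

text \<open>A clockwise loop bounded by two radii and two arcs: only the arcs, of radii \<open>r\<close> and \<open>r + \<rho>\<close>,
  change the height, by their angle times the power \<open>2m + 2\<close> of the radius.\<close>

lemma reach_vertical:
  assumes "0 \<le> m" "0 < norm w" "0 < \<rho>" "0 \<le> h"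
  shows "reach m (w, t) (w, t + h) (2 * \<rho> + (2 * norm w + \<rho>) *
           (h / ((norm w + \<rho>) powr (2 * m + 2) - norm w powr (2 * m + 2))))"
proof -
  obtain x y where w: "w = (x, y)" by (metis prod.exhaust)
  define r where "r = norm w"
  have "r > 0" using assms by (simp add: r_def)
  have "(x / r)\<^sup>2 + (y / r)\<^sup>2 = 1"
    using \<open>r > 0\<close> sum_power2_gt_zero_iff[of x y]
    by (simp add: r_def w norm_Pair power_divide flip: add_divide_distrib)
  then obtain \<theta> where "x / r = cos \<theta>" "y / r = sin \<theta>" using sincos_total_2pi by metis
  then have \<theta>: "w = (r * cos \<theta>, r * sin \<theta>)" using \<open>r > 0\<close> by (simp add: w field_simps)
  define D where "D = (r + \<rho>) powr (2 * m + 2) - r powr (2 * m + 2)"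
  have "D > 0" unfolding D_def using \<open>r > 0\<close> assms by (simp add: powr_less_mono2)
  \<comment> \<open>The outer arc gains \<open>(r + \<rho>)^(2m+2) * \<psi>\<close> and the inner
    one, walked backwards, gives back \<open>r^(2m+2) * \<psi>\<close>; this angle makes the balance
    exactly \<open>h\<close>.\<close>
  define \<psi> where "\<psi> = h / D"
  have "\<psi> \<ge> 0" using \<open>D > 0\<close> assms by (simp add: \<psi>_def)
  let ?p = "\<lambda>R \<phi> u. ((R * cos \<phi>, R * sin \<phi>), u) :: pt"
  have "t + (r + \<rho>) powr (2 * m + 2) * \<psi> = t + h + r powr (2 * m + 2) * \<psi>"
    using \<open>D > 0\<close> by (simp add: \<psi>_def D_def field_simps)
  note eq = this
  have 1: "reach m (?p r \<theta> t) (?p (r + \<rho>) \<theta> t) \<rho>"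
    using reach_radial assms by simp
  have 2: "reach m (?p (r + \<rho>) \<theta> t) (?p (r + \<rho>) (\<theta> - \<psi>) (t + h + r powr (2 * m + 2) * \<psi>)) ((r + \<rho>) * \<psi>)"
    using reach_arc[of "r + \<rho>" \<psi>] \<open>r > 0\<close> assms \<open>\<psi> \<ge> 0\<close> unfolding eq[symmetric] by simp
  have 3: "reach m (?p (r + \<rho>) (\<theta> - \<psi>) (t + h + r powr (2 * m + 2) * \<psi>))
      (?p r (\<theta> - \<psi>) (t + h + r powr (2 * m + 2) * \<psi>)) \<rho>"
    using reach_sym reach_radial assms by simp
  have 4: "reach m (?p r (\<theta> - \<psi>) (t + h + r powr (2 * m + 2) * \<psi>)) (?p r \<theta> (t + h)) (r * \<psi>)"
    using reach_sym reach_arc \<open>r > 0\<close> \<open>\<psi> \<ge> 0\<close> by simp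
  have "reach m (?p r \<theta> t) (?p r \<theta> (t + h)) (\<rho> + (r + \<rho>) * \<psi> + \<rho> + r * \<psi>)"
    using reach_trans[OF reach_trans[OF reach_trans[OF 1 2] 3] 4] .
  moreover have "\<rho> + (r + \<rho>) * \<psi> + \<rho> + r * \<psi> = 2 * \<rho> + (2 * r + \<rho>) * \<psi>"
    by (simp add: algebra_simps)
  ultimately have "reach m (w, t) (w, t + h) (2 * \<rho> + (2 * r + \<rho>) * \<psi>)"
    by (simp only: \<theta>[symmetric])
  then show ?thesis unfolding \<psi>_def D_def r_def .
qed

lemma continuous_on_norm_powr_line:
  assumes "0 < m"
  shows "continuous_on S (\<lambda>s. norm (x + s, y :: real) powr (2 * m))"
  using assms by (intro continuous_on_powr' continuous_intros) auto

text \<open>The start \<open>a\<close> is free because a diameter compares all pairs of points of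
  the flow line, not only those that contain its origin.\<close>

lemma reach_expX:
  assumes "0 < m" "0 \<le> a" "a \<le> b"
  shows "reach m (expX m a p) (expX m b p) (b - a)"
proof (rule reachI[where \<gamma> = "\<lambda>s. expX m (s + a) p" and \<alpha> = "\<lambda>_. 1" and \<beta> = "\<lambda>_. 0"])
  obtain x y t where p: "p = ((x, y), t)" by (metis prod.exhaust)
  let ?f = "\<lambda>\<rho>. norm (x + \<rho>, y) powr (2 * m)"
  have cont: "continuous_on {0..b} ?f" using assms by (intro continuous_on_norm_powr_line)
  have "continuous_on {0..b} (\<lambda>s. integral {0..s} ?f)"
    by (rule indefinite_integral_continuous_1) (rule integrable_continuous_interval[OF cont])
  then have "continuous_on {0..b - a} (\<lambda>s. integral {0..s + a} ?f)"
    by (rule continuous_on_compose2) (use assms in \<open>auto intro!: continuous_intros\<close>)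
  then show "continuous_on {0..b - a} (\<lambda>s. expX m (s + a) p)"
    unfolding expX_def p by (auto intro!: continuous_intros)
  fix s assume s: "s \<in> {0<..<b - a}"
  have "((\<lambda>s. integral {0..s} ?f) has_real_derivative ?f (s + a)) (at (s + a) within {0..b})"
    using s assms by (intro integral_has_real_derivative cont) auto
  moreover have "at (s + a) within {0..b} = at (s + a)"
    using s assms by (intro at_within_Icc_at) auto
  ultimately have "((\<lambda>s. integral {0..s} ?f) has_real_derivative ?f (s + a)) (at (s + a))" by simp
  then have "((\<lambda>s. integral {0..s + a} ?f) has_real_derivative ?f (s + a)) (at s)"
    by (simp only: DERIV_shift)
  then have "((\<lambda>s. ((x + (s + a), y), t + y * integral {0..s + a} ?f)) has_vector_derivative
      ((1, 0), y * ?f (s + a))) (at s)"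
    by (intro has_vector_derivative_Pair_Pair) (auto intro!: derivative_eq_intros)
  then show "((\<lambda>s. expX m (s + a) p) has_vector_derivative
      1 *\<^sub>R Xf m (expX m (s + a) p) + 0 *\<^sub>R Yf m (expX m (s + a) p)) (at s)"
    unfolding horizontal_field_eq by (simp add: expX_def p mult.commute)
qed (use assms in auto)

section \<open>Estimates from the hypotheses on the potential\<close>

lemma abs_dpart_le_Dnorm:
  assumes "length bs = k"
  shows "\<bar>dpart bs \<phi> z\<bar> \<le> Dnorm k \<phi> z"
proof -
  have "finite {bs :: bool list. length bs = k}"
    using finite_lists_length_eq[of "UNIV :: bool set" k] by simp
  then have "finite {\<bar>dpart bs \<phi> z\<bar> | bs. length bs = k}" by simp
  then show ?thesis unfolding Dnorm_def by (rule Max_ge) (use assms in blast)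
qed

lemma lipschitz_on_cball_of_partials:
  assumes diff: "\<And>z. g differentiable (at z)" and B: "\<And>b w. w \<in> cball 0 R \<Longrightarrow> \<bar>pd b g w\<bar> \<le> B"
    and uv: "u \<in> cball 0 R" "v \<in> cball 0 R"
  shows "\<bar>g v - g u\<bar> \<le> 2 * B * norm (v - u)"
proof -
  have "norm (g v - g u) \<le> 2 * B * norm (v - u)"
  proof (rule differentiable_bound[OF convex_cball _ _ uv(2,1)])
    fix w :: "real \<times> real" assume w: "w \<in> cball 0 R"
    show "(g has_derivative frechet_derivative g (at w)) (at w within cball 0 R)"
      using diff frechet_derivative_works has_derivative_at_withinI by blast
    have "norm (frechet_derivative g (at w) (h, k)) \<le> 2 * B * norm (h, k)" for h k
    proof -
      have "\<bar>h * pd False g w\<bar> \<le> norm (h, k) * B" "\<bar>k * pd True g w\<bar> \<le> norm (h, k) * B"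
        unfolding abs_mult using B[OF w] norm_fst_le[of h k] norm_snd_le[of k h] by (auto intro!: mult_mono)
      then show ?thesis
        unfolding frechet_derivative_eq_partials[OF diff] by (simp add: algebra_simps)
    qed
    then show "onorm (frechet_derivative g (at w)) \<le> 2 * B"
      by (intro onorm_le) auto
  qed
  then show ?thesis by simp
qed

lemma powr_diff_le:
  fixes a b p R :: real
  assumes "1 \<le> p" "0 \<le> a" "a \<le> b" "b \<le> R"
  shows "b powr p - a powr p \<le> p * R powr (p - 1) * (b - a)"
proof (cases "a = b")
  case False
  then have "a < b" using assms by simp
  have "\<exists>l x. a < x \<and> x < b \<and> ((\<lambda>x. x powr p) has_real_derivative l) (at x) \<and> b powr p - a powr p = (b - a) * l"
  proof (rule MVT[OF \<open>a < b\<close>])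
    show "continuous_on {a..b} (\<lambda>x. x powr p)"
      using assms by (intro continuous_on_powr' continuous_intros) auto
    \<comment> \<open>Interior points are positive even when \<open>a = 0\<close>, as
      \<open>has_real_derivative_powr\<close> requires.\<close>
    show "(\<lambda>x. x powr p) differentiable (at x)" if "a < x" "x < b" for x
      using that assms has_real_derivative_powr[of x p] unfolding real_differentiable_def by fastforce
  qed
  then obtain l x where x: "a < x" "x < b" "((\<lambda>x. x powr p) has_real_derivative l) (at x)"
    "b powr p - a powr p = (b - a) * l" by blast
  have "((\<lambda>x. x powr p) has_real_derivative p * x powr (p - 1)) (at x)"
    using x assms by (intro has_real_derivative_powr) auto
  then have "l = p * x powr (p - 1)" using x(3) DERIV_unique by blast
  moreover have "x powr (p - 1) \<le> R powr (p - 1)" using x assms by (intro powr_mono2) auto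
  ultimately have "l \<le> p * R powr (p - 1)" using assms by simp
  then show ?thesis using x(4) \<open>a < b\<close> by (simp add: mult.commute)
qed simp

text \<open>Meant for \<open>c\<close> and \<open>d\<close> the same coordinate of \<open>u\<close>
  and \<open>v\<close>, which gives the field terms of \<open>XF\<close> and \<open>YF\<close>.
  Varying one factor at a time, the power costs \<open>p * R^(p-1)\<close> times
  \<open>|c| <= R\<close>, and the coordinate costs \<open>R^p\<close>.\<close>

lemma norm_powr_mult_lipschitz:
  fixes u v :: "'a::real_normed_vector" and p c d R :: real
  assumes "1 \<le> p" "norm u \<le> R" "norm v \<le> R" "\<bar>c\<bar> \<le> R" "\<bar>d - c\<bar> \<le> norm (v - u)"
  shows "\<bar>norm v powr p * d - norm u powr p * c\<bar> \<le> (1 + p) * R powr p * norm (v - u)"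
proof -
  have "0 \<le> R" using assms(4) by linarith
  have "\<bar>norm v powr p - norm u powr p\<bar> \<le> p * R powr (p - 1) * \<bar>norm v - norm u\<bar>"
    using powr_diff_le[OF assms(1), of "norm u" "norm v" R] powr_diff_le[OF assms(1), of "norm v" "norm u" R]
      assms(2,3) powr_mono2[of p "norm u" "norm v"] powr_mono2[of p "norm v" "norm u"] assms(1)
    by (cases "norm u \<le> norm v") (auto simp: abs_if)
  also have "\<dots> \<le> p * R powr (p - 1) * norm (v - u)"
    using assms(1) by (intro mult_left_mono norm_triangle_ineq3) auto
  finally have "\<bar>norm v powr p - norm u powr p\<bar> * \<bar>c\<bar> \<le> (p * R powr (p - 1) * norm (v - u)) * R"
    using assms by (intro mult_mono) auto
  also have "\<dots> = p * R powr p * norm (v - u)"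
    using \<open>0 \<le> R\<close> powr_mult_base[of R "p - 1"] by (simp add: mult.commute mult.left_commute)
  finally have 1: "\<bar>(norm v powr p - norm u powr p) * c\<bar> \<le> p * R powr p * norm (v - u)"
    by (simp add: abs_mult)
  have 2: "\<bar>norm v powr p * (d - c)\<bar> \<le> R powr p * norm (v - u)"
    unfolding abs_mult using assms powr_mono2[of p "norm v" R] by (intro mult_mono) auto
  have "norm v powr p * d - norm u powr p * c = norm v powr p * (d - c) + (norm v powr p - norm u powr p) * c"
    by (simp add: algebra_simps)
  then show ?thesis using 1 2 by (simp add: distrib_right)
qed

text \<open>In each component the second derivatives of \<open>\<phi>\<close> contribute
  \<open>2 * C\<close> and the field term \<open>1 + 2 * m\<close>; the outer factor 2 adds the two
  components.\<close>

lemma ZF_lipschitz: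
  assumes "1 \<le> m" "smooth2 \<phi>" "0 < C" and D2: "\<And>z. Dnorm 2 \<phi> z \<le> C * norm z powr (2 * m)"
    and uv: "u \<in> cball 0 R" "v \<in> cball 0 R"
  shows "norm (ZF m \<phi> v - ZF m \<phi> u) \<le> 2 * (2 * C + 1 + 2 * m) * R powr (2 * m) * norm (v - u)"
proof -
  have diff: "pd b \<phi> differentiable (at z)" for b z
    using assms(2) unfolding smooth2_def by (metis dpart.simps)
  have pd2: "\<bar>pd a (pd b \<phi>) w\<bar> \<le> C * R powr (2 * m)" if "w \<in> cball 0 R" for a b w
  proof -
    have "\<bar>pd a (pd b \<phi>) w\<bar> \<le> Dnorm 2 \<phi> w"
      using abs_dpart_le_Dnorm[of "[a, b]" 2 \<phi> w] by simp
    also have "\<dots> \<le> C * norm w powr (2 * m)" by (rule D2)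
    also have "\<dots> \<le> C * R powr (2 * m)"
      using that assms by (intro mult_left_mono powr_mono2) auto
    finally show ?thesis .
  qed
  have pd1: "\<bar>pd b \<phi> v - pd b \<phi> u\<bar> \<le> 2 * (C * R powr (2 * m)) * norm (v - u)" for b
    by (rule lipschitz_on_cball_of_partials[OF diff pd2 uv])
  have nuv: "norm u \<le> R" "norm v \<le> R" using uv by auto
  have snd: "\<bar>norm v powr (2 * m) * snd v - norm u powr (2 * m) * snd u\<bar> \<le> (1 + 2 * m) * R powr (2 * m) * norm (v - u)"
    using assms(1) nuv norm_snd_le[of "snd u" "fst u"] norm_snd_le[of "snd (v - u)" "fst (v - u)"]
    by (intro norm_powr_mult_lipschitz) (auto simp: snd_diff[symmetric] simp del: fst_diff snd_diff)
  have fst: "\<bar>norm v powr (2 * m) * fst v - norm u powr (2 * m) * fst u\<bar> \<le> (1 + 2 * m) * R powr (2 * m) * norm (v - u)"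
    using assms(1) nuv norm_fst_le[of "fst u" "snd u"] norm_fst_le[of "fst (v - u)" "snd (v - u)"]
    by (intro norm_powr_mult_lipschitz) (auto simp: fst_diff[symmetric] simp del: fst_diff snd_diff)
  have X: "\<bar>XF m \<phi> v - XF m \<phi> u\<bar> \<le> (2 * C + 1 + 2 * m) * R powr (2 * m) * norm (v - u)"
    using pd1[of False] snd unfolding XF_def by (simp add: algebra_simps)
  have Y: "\<bar>YF m \<phi> v - YF m \<phi> u\<bar> \<le> (2 * C + 1 + 2 * m) * R powr (2 * m) * norm (v - u)"
    using pd1[of True] fst unfolding YF_def by (simp add: algebra_simps)
  have "norm (ZF m \<phi> v - ZF m \<phi> u) \<le> \<bar>XF m \<phi> v - XF m \<phi> u\<bar> + \<bar>YF m \<phi> v - YF m \<phi> u\<bar>"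
    using norm_Pair_le[of "XF m \<phi> v - XF m \<phi> u" "YF m \<phi> v - YF m \<phi> u"] by (simp add: ZF_def)
  then show ?thesis using X Y by linarith
qed

text \<open>Since \<open>0 powr k = 0\<close>, the first-order bound kills the gradient at the
  origin. Hence the Lipschitz estimate also bounds \<open>ZF\<close> itself, and a point with
  nonzero \<open>ZF\<close> lies off the axis.\<close>

lemma ZF_zero:
  assumes "Dnorm 1 \<phi> 0 \<le> C * norm (0 :: real \<times> real) powr (2 * m + 1)"
  shows "ZF m \<phi> 0 = 0"
proof -
  have "pd b \<phi> 0 = 0" for b
    using abs_dpart_le_Dnorm[of "[b]" 1 \<phi> 0] assms by simp
  then show ?thesis by (simp add: ZF_def XF_def YF_def zero_prod_def)
qed

lemma smooth2_lipschitz_on_cball: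
  assumes "smooth2 \<phi>" "0 \<le> C" "0 \<le> k" and D1: "\<And>z. Dnorm 1 \<phi> z \<le> C * norm z powr k"
  shows "\<exists>K. \<forall>u\<in>cball 0 R. \<forall>v\<in>cball 0 R. \<bar>\<phi> v - \<phi> u\<bar> \<le> K * norm (v - u)"
proof (intro exI ballI)
  fix u v :: "real \<times> real" assume uv: "u \<in> cball 0 R" "v \<in> cball 0 R"
  show "\<bar>\<phi> v - \<phi> u\<bar> \<le> 2 * (C * R powr k) * norm (v - u)"
  proof (rule lipschitz_on_cball_of_partials[OF _ _ uv])
    show "\<phi> differentiable (at z)" for z
      using assms(1) unfolding smooth2_def by (metis dpart.simps(1))
    fix b and w :: "real \<times> real" assume "w \<in> cball 0 R"
    then have "C * norm w powr k \<le> C * R powr k"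
      using assms by (intro mult_left_mono powr_mono2) auto
    then show "\<bar>pd b \<phi> w\<bar> \<le> C * R powr k"
      using abs_dpart_le_Dnorm[of "[b]" 1 \<phi> w] D1[of w] by simp
  qed
qed

text \<open>Along the flow of \<open>X\<close> the derivative of \<open>\<phi> - t\<close> is
  \<open>XF\<close>, so the bound on \<open>XF\<close> integrates.\<close>

lemma defining_function_along_expX_le:
  assumes "0 < m" "\<And>z. \<phi> differentiable (at z)" "0 \<le> s"
    and XF: "\<And>\<rho>. \<rho> \<in> {0..s} \<Longrightarrow> XF m \<phi> (z + (\<rho>, 0)) \<le> - \<kappa>"
  shows "\<phi> (fst (expX m s (z, t))) - snd (expX m s (z, t)) \<le> \<phi> z - t - \<kappa> * s"
proof -
  obtain x y where z: "z = (x, y)" by (metis prod.exhaust)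
  let ?f = "\<lambda>\<rho>. norm (x + \<rho>, y) powr (2 * m)"
  have "((\<lambda>\<rho>. pd False \<phi> (x + \<rho>, y)) has_integral \<phi> (x + s, y) - \<phi> (x + 0, y)) {0..s}"
  proof (rule fundamental_theorem_of_calculus[OF \<open>0 \<le> s\<close>])
    fix \<rho>
    have "((\<lambda>\<rho>. (x + \<rho>, y)) has_derivative (\<lambda>h. (h, 0))) (at \<rho> within {0..s})"
      by (auto intro!: derivative_eq_intros)
    then have "((\<lambda>\<rho>. \<phi> (x + \<rho>, y)) has_derivative (\<lambda>h. frechet_derivative \<phi> (at (x + \<rho>, y)) (h, 0))) (at \<rho> within {0..s})"
      by (rule has_derivative_compose) (use assms(2) frechet_derivative_works in blast)
    then show "((\<lambda>\<rho>. \<phi> (x + \<rho>, y)) has_vector_derivative pd False \<phi> (x + \<rho>, y)) (at \<rho> within {0..s})"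
      unfolding has_vector_derivative_def frechet_derivative_eq_partials[OF assms(2)] by simp
  qed
  moreover have "(?f has_integral integral {0..s} ?f) {0..s}"
    by (intro integrable_integral integrable_continuous_interval continuous_on_norm_powr_line assms)
  ultimately have "((\<lambda>\<rho>. pd False \<phi> (x + \<rho>, y) - ?f \<rho> * y) has_integral
      (\<phi> (x + s, y) - \<phi> (x + 0, y) - integral {0..s} ?f * y)) {0..s}"
    by (intro has_integral_diff has_integral_mult_left)
  moreover have "((\<lambda>_. - \<kappa>) has_integral (- \<kappa> * s)) {0..s}"
    using has_integral_const_real[of "- \<kappa>" 0 s] \<open>0 \<le> s\<close> by (simp add: mult.commute)
  ultimately have "\<phi> (x + s, y) - \<phi> (x + 0, y) - integral {0..s} ?f * y \<le> - \<kappa> * s"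
    by (rule has_integral_le) (use XF in \<open>auto simp: z XF_def\<close>)
  then show ?thesis by (simp add: expX_def z algebra_simps)
qed

section \<open>Upper bounds for diameters\<close>

lemma cc_diam_image_le:
  fixes g :: "real \<Rightarrow> pt"
  assumes "0 \<le> m" and "\<And>a b. \<lbrakk>0 \<le> a; a \<le> b; b \<le> s\<rbrakk> \<Longrightarrow> \<exists>T\<le>D. reach m (g a) (g b) T"
  shows "cc_diam m (g ` {0..s}) \<le> ennreal D"
  unfolding cc_diam_def
proof (rule SUP_least)
  fix pq assume "pq \<in> g ` {0..s} \<times> g ` {0..s}"
  then obtain a b where ab: "pq = (g a, g b)" "a \<in> {0..s}" "b \<in> {0..s}" by auto
  have "\<exists>T\<le>D. reach m (g a) (g b) T"
  proof (cases "a \<le> b")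
    case False
    then have "\<exists>T\<le>D. reach m (g b) (g a) T" using ab by (intro assms(2)) auto
    then show ?thesis using reach_sym by blast
  qed (use assms(2) ab in auto)
  then obtain T where "T \<le> D" "reach m (g a) (g b) T" by blast
  then show "cc_dist m (fst pq) (snd pq) \<le> ennreal D"
    using reach_imp_cc_dist_le[OF assms(1)] ab(1) ennreal_leI order_trans by (metis fst_conv snd_conv)
qed

text \<open>Write \<open>r\<close> for \<open>norm w\<close> and \<open>D\<close> for the difference
  of powers in \<open>reach_vertical\<close>, whose loop costs
  \<open>2 * \<rho> + (2 * r + \<rho>) * h' / D\<close>. If \<open>\<rho> <= r\<close>, then
  \<open>D >= \<rho> * r^(2m+1)\<close> and \<open>2 * r + \<rho> <= 3 * r\<close>; if
  \<open>r <= \<rho>\<close>, then \<open>D >= h\<close> and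
  \<open>2 * r + \<rho> <= 3 * \<rho>\<close>. Either way the second term is at most
  \<open>3 * \<rho>\<close>. The cost grows with \<open>h'\<close>, so one \<open>\<rho>\<close>
  serves every subsegment.\<close>

lemma reach_vertical_bound:
  assumes "0 \<le> m" "0 < norm w" "0 < h"
  shows "\<exists>\<rho>>0. (h = \<rho>\<^sup>2 * norm w powr (2 * m) \<and> \<rho> \<le> norm w \<or>
      h = \<rho> powr (2 * m + 2) \<and> norm w \<le> \<rho>) \<and>
    (\<forall>t. \<forall>h'\<in>{0..h}. \<exists>T\<le>5 * \<rho>. reach m (w, t) (w, t + h') T)"
proof -
  define r where "r = norm w"
  have r: "0 < r" using assms by (simp add: r_def)
  have pow: "u powr (2 * m + 2) = u * u powr (2 * m + 1)" "u powr (2 * m + 1) = u * u powr (2 * m)" if "0 < u" for u :: real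
    using that powr_mult_base[of u "2 * m + 1"] powr_mult_base[of u "2 * m"] by (auto simp: add.commute)
  have "\<exists>\<rho>>0. (h = \<rho>\<^sup>2 * r powr (2 * m) \<and> \<rho> \<le> r \<or> h = \<rho> powr (2 * m + 2) \<and> r \<le> \<rho>) \<and>
      (2 * r + \<rho>) * h \<le> 3 * \<rho> * ((r + \<rho>) powr (2 * m + 2) - r powr (2 * m + 2))"
  proof (cases "h \<le> r powr (2 * m + 2)")
    case True
    define \<rho> where "\<rho> = sqrt (h / r powr (2 * m))"
    have "0 < \<rho>" using assms r by (simp add: \<rho>_def)
    have h: "h = \<rho>\<^sup>2 * r powr (2 * m)" using assms r by (simp add: \<rho>_def)
    have "h \<le> r\<^sup>2 * r powr (2 * m)" using True pow[OF r] by (simp add: power2_eq_square)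
    then have "\<rho>\<^sup>2 * r powr (2 * m) \<le> r\<^sup>2 * r powr (2 * m)" by (simp only: h[symmetric])
    then have "\<rho>\<^sup>2 \<le> r\<^sup>2" by (rule mult_right_le_imp_le) (use r in simp)
    then have "\<rho> \<le> r" by (rule power2_le_imp_le) (use r in simp)
    \<comment> \<open>Peeling off one factor:
      \<open>(r + \<rho>) * r^(2m+1) - r^(2m+2) = \<rho> * r^(2m+1)\<close>.\<close>
    have "(r + \<rho>) powr (2 * m + 1) \<ge> r powr (2 * m + 1)"
      using r \<open>0 < \<rho>\<close> assms by (intro powr_mono2) auto
    then have "(r + \<rho>) * (r + \<rho>) powr (2 * m + 1) \<ge> (r + \<rho>) * r powr (2 * m + 1)"
      using r \<open>0 < \<rho>\<close> by (intro mult_left_mono) auto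
    then have "(r + \<rho>) powr (2 * m + 2) - r powr (2 * m + 2) \<ge> \<rho> * r powr (2 * m + 1)"
      using pow(1)[OF r] pow(1)[of "r + \<rho>"] r \<open>0 < \<rho>\<close> by (simp add: distrib_right)
    then have "3 * \<rho> * (\<rho> * r powr (2 * m + 1)) \<le> 3 * \<rho> * ((r + \<rho>) powr (2 * m + 2) - r powr (2 * m + 2))"
      using \<open>0 < \<rho>\<close> by (intro mult_left_mono) auto
    moreover have "(2 * r + \<rho>) * h \<le> (3 * r) * h" using \<open>\<rho> \<le> r\<close> assms by (intro mult_right_mono) auto
    moreover have "(3 * r) * h = 3 * \<rho> * (\<rho> * r powr (2 * m + 1))"
      using pow(2)[OF r] by (simp add: h power2_eq_square)
    ultimately have "(2 * r + \<rho>) * h \<le> 3 * \<rho> * ((r + \<rho>) powr (2 * m + 2) - r powr (2 * m + 2))"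
      by linarith
    then show ?thesis using \<open>0 < \<rho>\<close> h \<open>\<rho> \<le> r\<close> by blast
  next
    case False
    define \<rho> where "\<rho> = h powr (1 / (2 * m + 2))"
    have "0 < \<rho>" using assms by (simp add: \<rho>_def)
    have "1 / (2 * m + 2) * (2 * m + 2) = 1" using assms(1) by simp
    then have h: "h = \<rho> powr (2 * m + 2)" using assms by (simp add: \<rho>_def powr_powr)
    have "r \<le> \<rho>"
    proof (rule ccontr)
      assume "\<not> r \<le> \<rho>"
      then have "h \<le> r powr (2 * m + 2)" unfolding h using \<open>0 < \<rho>\<close> assms by (intro powr_mono2) auto
      then show False using False by simp
    qed
    \<comment> \<open>Superadditivity of the power \<open>2 * m + 2\<close>, again by peeling off
      the factor \<open>r + \<rho>\<close>.\<close>
    have "(r + \<rho>) powr (2 * m + 1) \<ge> r powr (2 * m + 1)" "(r + \<rho>) powr (2 * m + 1) \<ge> \<rho> powr (2 * m + 1)"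
      using r \<open>0 < \<rho>\<close> assms by (auto intro!: powr_mono2)
    then have "r * (r + \<rho>) powr (2 * m + 1) + \<rho> * (r + \<rho>) powr (2 * m + 1) \<ge> r * r powr (2 * m + 1) + \<rho> * \<rho> powr (2 * m + 1)"
      using r \<open>0 < \<rho>\<close> by (intro add_mono mult_left_mono) auto
    then have "(r + \<rho>) powr (2 * m + 2) - r powr (2 * m + 2) \<ge> h"
      using pow(1)[OF r] pow(1)[of "r + \<rho>"] pow(1)[OF \<open>0 < \<rho>\<close>] r \<open>0 < \<rho>\<close> h by (simp add: distrib_right)
    moreover have "2 * r + \<rho> \<le> 3 * \<rho>" using \<open>r \<le> \<rho>\<close> by simp
    ultimately have "(2 * r + \<rho>) * h \<le> 3 * \<rho> * ((r + \<rho>) powr (2 * m + 2) - r powr (2 * m + 2))"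
      using assms r \<open>0 < \<rho>\<close> by (intro mult_mono) auto
    then show ?thesis using \<open>0 < \<rho>\<close> h \<open>r \<le> \<rho>\<close> by blast
  qed
  then obtain \<rho> where "0 < \<rho>"
    and alt: "h = \<rho>\<^sup>2 * r powr (2 * m) \<and> \<rho> \<le> r \<or> h = \<rho> powr (2 * m + 2) \<and> r \<le> \<rho>"
    and le: "(2 * r + \<rho>) * h \<le> 3 * \<rho> * ((r + \<rho>) powr (2 * m + 2) - r powr (2 * m + 2))"
    by blast
  define D where "D = (r + \<rho>) powr (2 * m + 2) - r powr (2 * m + 2)"
  have "D > 0" unfolding D_def using r \<open>0 < \<rho>\<close> assms by (simp add: powr_less_mono2)
  have "\<exists>T\<le>5 * \<rho>. reach m (w, t) (w, t + h') T" if "h' \<in> {0..h}" for t h'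
  proof -
    have h': "0 \<le> h'" "h' \<le> h" using that by auto
    have "(2 * r + \<rho>) * h' \<le> (2 * r + \<rho>) * h" using h' r \<open>0 < \<rho>\<close> by (intro mult_left_mono) auto
    then have "(2 * r + \<rho>) * h' \<le> 3 * \<rho> * D" using le by (simp add: D_def)
    then have "(2 * r + \<rho>) * (h' / D) \<le> 3 * \<rho>" using \<open>D > 0\<close> by (simp add: pos_divide_le_eq)
    then have "2 * \<rho> + (2 * r + \<rho>) * (h' / D) \<le> 5 * \<rho>" by simp
    then show ?thesis
      using reach_vertical[OF assms(1,2) \<open>0 < \<rho>\<close> h'(1)] unfolding D_def r_def by blast
  qed
  then show ?thesis using \<open>0 < \<rho>\<close> alt unfolding r_def by blast
qed

section \<open>The escaping curve\<close>

lemma fst_expX: "fst (expX m s (z, t)) = z + (s, 0)"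
  by (cases z) (simp add: expX_def)

text \<open>Serves the regime \<open>\<rho> <= R\<close>. There \<open>ZF\<close> is at most
  \<open>N + K * P * (\<sigma> + r)\<close>, and \<open>N = 4 * K * P * \<sigma>\<close> turns this
  into \<open>P * (5 * K * \<sigma> + K * r)\<close>; the left side is this bound times
  \<open>r = lam * (\<sigma> + 5 * \<rho>)\<close>, divided by \<open>P\<close>. It equals
  \<open>K * lam\<close> times a quadratic form in \<open>\<sigma>\<close> and
  \<open>\<rho>\<close>, which is at most the form with coefficients 6, 35 and 25, so the constant
  400 leaves ample room.\<close>

lemma near_ball_estimate:
  fixes K c \<sigma> \<rho> :: real
  assumes "1 \<le> K" "1 \<le> c"
  defines "lam \<equiv> 1 / (400 * K * c)"
  shows "(5 * K * \<sigma> + K * (lam * (\<sigma> + 5 * \<rho>))) * (lam * (\<sigma> + 5 * \<rho>)) \<le> K * \<sigma>\<^sup>2 + \<rho>\<^sup>2 / c"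
proof -
  have K_lam: "K * lam = 1 / (400 * c)" using assms by (simp add: lam_def)
  have "1 * 1 \<le> K * c" using assms by (intro mult_mono) auto
  then have "0 \<le> lam" "lam \<le> 1" by (auto simp: lam_def)
  have "(5 * K * \<sigma> + K * (lam * (\<sigma> + 5 * \<rho>))) * (lam * (\<sigma> + 5 * \<rho>)) =
      (K * lam) * (5 * \<sigma> * (\<sigma> + 5 * \<rho>) + lam * (\<sigma> + 5 * \<rho>)\<^sup>2)"
    by (simp add: power2_eq_square algebra_simps)
  also have "\<dots> \<le> 1 / (400 * c) * (400 * (\<sigma>\<^sup>2 + \<rho>\<^sup>2))"
    unfolding K_lam
  proof (intro mult_left_mono)
    have "lam * (\<sigma> + 5 * \<rho>)\<^sup>2 \<le> 1 * (\<sigma> + 5 * \<rho>)\<^sup>2"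
      using \<open>lam \<le> 1\<close> by (intro mult_right_mono) auto
    also have "\<dots> = \<sigma>\<^sup>2 + 10 * (\<sigma> * \<rho>) + 25 * \<rho>\<^sup>2"
      by (simp add: power2_eq_square algebra_simps)
    finally have "5 * \<sigma> * (\<sigma> + 5 * \<rho>) + lam * (\<sigma> + 5 * \<rho>)\<^sup>2 \<le>
        (5 * \<sigma>\<^sup>2 + 25 * (\<sigma> * \<rho>)) + (\<sigma>\<^sup>2 + 10 * (\<sigma> * \<rho>) + 25 * \<rho>\<^sup>2)"
      by (intro add_mono) (simp_all add: power2_eq_square algebra_simps)
    also have "\<dots> \<le> 400 * (\<sigma>\<^sup>2 + \<rho>\<^sup>2)"
    proof -
      have "(5 * A + 25 * X) + (A + 10 * X + 25 * B) \<le> 400 * (A + B)"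
        if "2 * X \<le> A + B" "0 \<le> A" "0 \<le> B" for A B X :: real
        using that by argo
      from this[OF sum_squares_bound[of \<sigma> \<rho>, unfolded mult.assoc] zero_le_power2 zero_le_power2]
      show ?thesis .
    qed
    finally show "5 * \<sigma> * (\<sigma> + 5 * \<rho>) + lam * (\<sigma> + 5 * \<rho>)\<^sup>2 \<le> 400 * (\<sigma>\<^sup>2 + \<rho>\<^sup>2)" .
  qed (use assms in auto)
  also have "\<dots> = \<sigma>\<^sup>2 / c + \<rho>\<^sup>2 / c" using assms by (simp add: field_simps)
  also have "\<sigma>\<^sup>2 / c \<le> K * \<sigma>\<^sup>2"
  proof -
    have "\<sigma>\<^sup>2 \<le> (K * c) * \<sigma>\<^sup>2" using \<open>1 * 1 \<le> K * c\<close> by (simp add: mult_le_cancel_right1)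
    then show ?thesis using assms by (simp add: divide_le_eq mult.commute mult.left_commute)
  qed
  finally show ?thesis by simp
qed

theorem theorem5p2:
  fixes m :: real and \<phi> :: "real \<times> real \<Rightarrow> real" and C :: real
  assumes "m \<ge> 1"
    and "smooth2 \<phi>"
    and "C > 0"
    and "\<And>z. Dnorm 3 \<phi> z \<le> C * norm z powr (2 * m - 1)"
    and "\<And>z. Dnorm 2 \<phi> z \<le> C * norm z powr (2 * m)"
    and "\<And>z. Dnorm 1 \<phi> z \<le> C * norm z powr (2 * m + 1)"
  shows "\<exists>eps0 > 0. \<exists>lam > 0. \<forall>z t.
           - XF m \<phi> z > norm (ZF m \<phi> z) / 2 \<and> (z, t) \<in> epi \<phi> \<longrightarrow>
           (\<forall>s \<ge> 0. gam m \<phi> eps0 z t s \<in> epi \<phi>) \<and>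
           (\<forall>s > 0. cc_ball m (gam m \<phi> eps0 z t s)
                       (ennreal lam * cc_diam m (gam m \<phi> eps0 z t ` {0..s})) \<subseteq> epi \<phi>)"
proof -
  have "0 \<le> m" "0 < m" using assms(1) by auto
  have diff: "\<phi> differentiable (at z)" for z
    using assms(2) unfolding smooth2_def by (metis dpart.simps(1))
  have lip: "\<exists>K. \<forall>u\<in>cball 0 R. \<forall>v\<in>cball 0 R. \<bar>\<phi> v - \<phi> u\<bar> \<le> K * norm (v - u)" for R
    by (rule smooth2_lipschitz_on_cball[OF assms(2) _ _ assms(6)]) (use assms in auto)
  define K0 where "K0 = 2 * (2 * C + 1 + 2 * m)"
  have "1 \<le> K0" using assms by (simp add: K0_def)
  have ZF_lip: "norm (ZF m \<phi> v - ZF m \<phi> u) \<le> K0 * R powr (2 * m) * norm (v - u)"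
    if "norm u \<le> R" "norm v \<le> R" for u v R
    unfolding K0_def by (rule ZF_lipschitz[OF assms(1-3,5)]) (use that in auto)
  have ZF_0: "ZF m \<phi> 0 = 0" using ZF_zero[OF assms(6)] .
  have ZF_le: "norm (ZF m \<phi> w) \<le> K0 * R powr (2 * m) * R" if "norm w \<le> R" for w R
  proof -
    have "0 \<le> R" using that norm_ge_zero order_trans by blast
    have "norm (ZF m \<phi> w) \<le> K0 * R powr (2 * m) * norm w"
      using ZF_lip[of 0 R w] that \<open>0 \<le> R\<close> by (simp add: ZF_0)
    also have "\<dots> \<le> K0 * R powr (2 * m) * R"
      using that \<open>1 \<le> K0\<close> by (intro mult_left_mono) auto
    finally show ?thesis .
  qed
  \<comment> \<open>The factor by which the power \<open>2 * m\<close> of a radius changes when the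
    radius is doubled or halved.\<close>
  define c :: real where "c = 2 powr (2 * m)"
  have "1 \<le> c" using \<open>0 \<le> m\<close> by (simp add: c_def ge_one_powr_ge_zero)
  define K where "K = K0 * c"
  have "1 * 1 \<le> K0 * c" using \<open>1 \<le> K0\<close> \<open>1 \<le> c\<close> by (intro mult_mono) auto
  then have "1 \<le> K" by (simp add: K_def)
  \<comment> \<open>Before time \<open>\<sigma>\<close>, \<open>XF\<close> moves by at most
    \<open>K * P * \<sigma> = N / 4\<close> and so stays below
    \<open>- N / 2 + N / 4\<close>.\<close>
  define eps0 where "eps0 = 1 / (4 * K)"
  define lam where "lam = 1 / (400 * K * c)"
  have K_lam: "K * lam = 1 / (400 * c)" using \<open>1 \<le> K\<close> by (simp add: lam_def)
  have K_lam_le: "K * lam \<le> 1 / 400" unfolding K_lam using \<open>1 \<le> c\<close> by (simp add: field_simps)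
  have "0 < lam" using \<open>1 \<le> K\<close> \<open>1 \<le> c\<close> by (simp add: lam_def)
  moreover have "lam \<le> K * lam" using \<open>1 \<le> K\<close> \<open>0 < lam\<close> by simp
  ultimately have lam_le: "lam \<le> 1 / 400" using K_lam_le by linarith
  have "0 < eps0" using \<open>1 \<le> K\<close> by (simp add: eps0_def)
  have "(\<forall>s \<ge> 0. gam m \<phi> eps0 z t s \<in> epi \<phi>) \<and>
      (\<forall>s > 0. cc_ball m (gam m \<phi> eps0 z t s) (ennreal lam * cc_diam m (gam m \<phi> eps0 z t ` {0..s})) \<subseteq> epi \<phi>)"
    if XF_neg: "- XF m \<phi> z > norm (ZF m \<phi> z) / 2" and in_epi: "(z, t) \<in> epi \<phi>" for z t
  proof -
    define N where "N = norm (ZF m \<phi> z)"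
    define a where "a = norm z"
    define P where "P = a powr (2 * m)"
    define \<sigma> where "\<sigma> = eps0 * N / P"
    define \<gamma> where "\<gamma> = gam m \<phi> eps0 z t"
    define F where "F p = \<phi> (fst p) - snd p" for p :: pt
    have XF_le_ZF: "\<bar>XF m \<phi> v - XF m \<phi> u\<bar> \<le> norm (ZF m \<phi> v - ZF m \<phi> u)" for u v
      using norm_fst_le[of "XF m \<phi> v - XF m \<phi> u" "YF m \<phi> v - YF m \<phi> u"] by (simp add: ZF_def)
    have "\<bar>XF m \<phi> z\<bar> \<le> N" using norm_fst_le[of "XF m \<phi> z" "YF m \<phi> z"] by (simp add: ZF_def N_def)
    then have "0 < N" using XF_neg unfolding N_def by (smt (verit) norm_ge_zero field_sum_of_halves)
    then have "z \<noteq> 0" using ZF_0 by (auto simp: N_def)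
    then have "0 < a" "0 < P" by (auto simp: a_def P_def)
    have "0 < \<sigma>" using \<open>0 < N\<close> \<open>0 < P\<close> \<open>0 < eps0\<close> by (simp add: \<sigma>_def)
    have N_eq: "N = 4 * K * P * \<sigma>" using \<open>0 < P\<close> \<open>1 \<le> K\<close> by (simp add: \<sigma>_def eps0_def)
    \<comment> \<open>Because \<open>ZF\<close> vanishes at the origin, \<open>N\<close> is at most
      \<open>K * P * a\<close>. Hence the curve projects to radii between \<open>3 * a / 4\<close>
      and \<open>5 * a / 4\<close>, and \<open>near\<close> applies along it.\<close>
    have \<sigma>_le: "\<sigma> \<le> a / 4"
    proof -
      have "N \<le> K0 * P * a" using ZF_le[of z a] by (simp add: N_def P_def a_def)
      also have "\<dots> \<le> K * P * a"
        unfolding K_def using \<open>0 < a\<close> \<open>0 < P\<close> \<open>1 \<le> c\<close> \<open>1 \<le> K0\<close> by (intro mult_right_mono) auto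
      finally have "(K * P) * (4 * \<sigma>) \<le> (K * P) * a" unfolding N_eq by (simp add: algebra_simps)
      then have "4 * \<sigma> \<le> a"
        by (rule mult_left_le_imp_le) (use \<open>1 \<le> K\<close> \<open>0 < P\<close> in simp)
      then show ?thesis by simp
    qed
    have near: "norm (ZF m \<phi> w - ZF m \<phi> z) \<le> K * P * norm (w - z)" if "norm (w - z) \<le> a" for w
    proof -
      have "norm w \<le> 2 * a" using that norm_triangle_ineq2[of w z] by (simp add: a_def)
      then show ?thesis
        using ZF_lip[of z "2 * a" w] \<open>0 < a\<close> by (simp add: K_def c_def P_def a_def powr_mult)
    qed
    have norm_shift: "norm (z + (\<rho>, 0) - z) = \<rho>" if "0 \<le> \<rho>" for \<rho> :: real
      using that by (simp add: norm_Pair)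
    have \<gamma>_le: "\<gamma> s = expX m s (z, t)" if "s \<le> \<sigma>" for s
      using that by (simp add: \<gamma>_def gam_def Let_def \<sigma>_def N_def P_def a_def)
    have \<gamma>_gt: "\<gamma> s = (z + (\<sigma>, 0), snd (expX m \<sigma> (z, t)) + (s - \<sigma>))" if "\<sigma> < s" for s
    proof -
      have "\<gamma> s = expX m \<sigma> (z, t) + ((0, 0), s - \<sigma>)"
        using that by (simp add: \<gamma>_def gam_def Let_def \<sigma>_def N_def P_def a_def)
      then show ?thesis by (simp add: prod_eq_iff fst_expX)
    qed
    have F_le: "F (\<gamma> s) < - (N / 4 * s)" if "0 \<le> s" "s \<le> \<sigma>" for s
    proof -
      have "XF m \<phi> (z + (\<rho>, 0)) \<le> - (N / 4)" if \<rho>: "\<rho> \<in> {0..s}" for \<rho>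
      proof -
        have "\<bar>XF m \<phi> (z + (\<rho>, 0)) - XF m \<phi> z\<bar> \<le> K * P * norm (z + (\<rho>, 0) - z)"
          using \<rho> \<open>s \<le> \<sigma>\<close> \<sigma>_le \<open>0 < a\<close> by (intro order_trans[OF XF_le_ZF near]) (simp add: norm_Pair)
        also have "\<dots> \<le> K * P * \<sigma>"
          using \<rho> \<open>s \<le> \<sigma>\<close> \<open>1 \<le> K\<close> \<open>0 < P\<close> by (subst norm_shift) (auto intro!: mult_left_mono)
        finally show ?thesis using XF_neg N_eq by (simp add: N_def)
      qed
      then have "F (\<gamma> s) \<le> \<phi> z - t - N / 4 * s"
        unfolding F_def \<gamma>_le[OF that(2)]
        by (rule defining_function_along_expX_le[OF \<open>0 < m\<close> diff that(1)])
      then show ?thesis using in_epi by (simp add: epi_def)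
    qed
    have F_gt: "F (\<gamma> s) < - (N / 4 * \<sigma>) - (s - \<sigma>)" if "\<sigma> < s" for s
    proof -
      have "F (\<gamma> s) = F (\<gamma> \<sigma>) - (s - \<sigma>)"
        unfolding F_def by (simp add: \<gamma>_gt[OF that] \<gamma>_le[OF order_refl] fst_expX)
      then show ?thesis using F_le[of \<sigma>] \<open>0 < \<sigma>\<close> by simp
    qed
    have epi_iff: "p \<in> epi \<phi> \<longleftrightarrow> F p < 0" for p by (cases p) (simp add: epi_def F_def)
    have "\<gamma> s \<in> epi \<phi>" if "0 \<le> s" for s
    proof (cases "s \<le> \<sigma>")
      case True
      moreover have "0 \<le> N / 4 * s" using \<open>0 < N\<close> that by simp
      ultimately show ?thesis using F_le[OF that] unfolding epi_iff by linarith
    next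
      case False
      moreover have "0 \<le> N / 4 * \<sigma>" using \<open>0 < N\<close> \<open>0 < \<sigma>\<close> by simp
      ultimately show ?thesis using F_gt[of s] unfolding epi_iff by linarith
    qed
    moreover have "cc_ball m (\<gamma> s) (ennreal lam * cc_diam m (\<gamma> ` {0..s})) \<subseteq> epi \<phi>" if "0 < s" for s
    proof -
      \<comment> \<open>Reduces every case to one inequality: any upper bound \<open>D\<close> for
        the diameter will do, and \<open>M\<close> has to bound \<open>ZF\<close> only on a planar
        disc of radius \<open>lam * D\<close>.\<close>
      have ball: "cc_ball m (\<gamma> s) (ennreal lam * cc_diam m (\<gamma> ` {0..s})) \<subseteq> epi \<phi>"
        if "0 \<le> D" and diam: "\<And>u v. \<lbrakk>0 \<le> u; u \<le> v; v \<le> s\<rbrakk> \<Longrightarrow> \<exists>T\<le>D. reach m (\<gamma> u) (\<gamma> v) T"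
          and M: "\<And>w. norm (w - fst (\<gamma> s)) \<le> lam * D \<Longrightarrow> norm (ZF m \<phi> w) \<le> M"
          and F: "F (\<gamma> s) + M * (lam * D) < 0" for D M
      proof
        fix q assume "q \<in> cc_ball m (\<gamma> s) (ennreal lam * cc_diam m (\<gamma> ` {0..s}))"
        then have "cc_dist m (\<gamma> s) q < ennreal lam * cc_diam m (\<gamma> ` {0..s})"
          by (simp add: cc_ball_def)
        also have "\<dots> \<le> ennreal lam * ennreal D"
          by (intro mult_left_mono cc_diam_image_le[OF \<open>0 \<le> m\<close> diam]) auto
        also have "\<dots> = ennreal (lam * D)" using \<open>0 < lam\<close> \<open>0 \<le> D\<close> by (simp add: ennreal_mult)
        finally have "\<bar>F q - F (\<gamma> s)\<bar> \<le> M * (lam * D)"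
          unfolding F_def
          by (rule cc_dist_less_defining_function_bound[OF diff lip])
            (use M in \<open>simp add: dist_norm norm_minus_commute\<close>)
        then show "q \<in> epi \<phi>" using F unfolding epi_iff by linarith
      qed
      have reach_X: "reach m (\<gamma> u) (\<gamma> v) (v - u)" if "0 \<le> u" "u \<le> v" "v \<le> \<sigma>" for u v
        using reach_expX[OF \<open>0 < m\<close> that(1,2)] \<gamma>_le[of u] \<gamma>_le[of v] that by auto
      show ?thesis
      proof (cases "s \<le> \<sigma>")
        case True
        show ?thesis
        \<comment> \<open>The disc lies within \<open>2 * \<sigma>\<close> of \<open>z\<close>,
          where \<open>ZF\<close> differs from its value at \<open>z\<close> by at most
          \<open>2 * K * P * \<sigma> = N / 2\<close>. The variation, \<open>3 / 2 * N\<close> times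
          at most \<open>s / 400\<close>, stays below the drop \<open>N / 4 * s\<close>.\<close>
        proof (rule ball[where D = s and M = "3 / 2 * N"])
          show "\<exists>T\<le>s. reach m (\<gamma> u) (\<gamma> v) T" if "0 \<le> u" "u \<le> v" "v \<le> s" for u v
            using reach_X[OF that(1,2)] that True by (intro exI[of _ "v - u"]) auto
          have lam_s: "lam * s \<le> 1 / 400 * s" using lam_le \<open>0 < s\<close> by (intro mult_right_mono) auto
          have "N * (lam * s) \<le> N * (1 / 400 * s)" using lam_s \<open>0 < N\<close> by (intro mult_left_mono) auto
          moreover have "0 < N * s" using \<open>0 < N\<close> \<open>0 < s\<close> by simp
          ultimately show "F (\<gamma> s) + 3 / 2 * N * (lam * s) < 0"
            using F_le[of s] True \<open>0 < s\<close> by (simp add: algebra_simps)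
          fix w assume "norm (w - fst (\<gamma> s)) \<le> lam * s"
          moreover have "fst (\<gamma> s) = z + (s, 0)" by (simp add: \<gamma>_le[OF True] fst_expX)
          ultimately have "norm (w - (z + (s, 0))) \<le> lam * s" by simp
          then have "norm (w - (z + (s, 0))) \<le> s" using lam_s \<open>0 < s\<close> by linarith
          moreover have "w - z = (w - (z + (s, 0))) + (z + (s, 0) - z)" by simp
          ultimately have w: "norm (w - z) \<le> 2 * \<sigma>"
            using norm_triangle_ineq[of "w - (z + (s, 0))" "z + (s, 0) - z"] norm_shift[of s] \<open>0 < s\<close> True
            by simp
          then have "norm (ZF m \<phi> w - ZF m \<phi> z) \<le> K * P * (2 * \<sigma>)"
            using \<sigma>_le \<open>1 \<le> K\<close> \<open>0 < P\<close> \<open>0 < a\<close>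
            by (intro order_trans[OF near mult_left_mono]) auto
          then show "norm (ZF m \<phi> w) \<le> 3 / 2 * N"
            using norm_triangle_ineq2[of "ZF m \<phi> w" "ZF m \<phi> z"] N_eq by (simp add: N_def)
        qed (use \<open>0 < s\<close> in auto)
      next
        case False
        define h where "h = s - \<sigma>"
        define w0 where "w0 = z + (\<sigma>, 0)"
        have "0 < h" "\<sigma> < s" using False by (auto simp: h_def)
        have fst_\<gamma>: "fst (\<gamma> s) = w0" using \<gamma>_gt[OF \<open>\<sigma> < s\<close>] by (simp add: w0_def)
        have w0_z: "norm (w0 - z) = \<sigma>" using norm_shift[of \<sigma>] \<open>0 < \<sigma>\<close> by (simp only: w0_def)
        have w0: "norm w0 \<le> a + \<sigma>" "a - \<sigma> \<le> norm w0"
          using w0_z norm_triangle_ineq2[of w0 z] norm_triangle_ineq2[of z w0]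
          by (auto simp: a_def norm_minus_commute)
        then have "0 < norm w0" using \<sigma>_le \<open>0 < a\<close> by linarith
        obtain \<rho> where "0 < \<rho>"
          and alt: "h = \<rho>\<^sup>2 * norm w0 powr (2 * m) \<and> \<rho> \<le> norm w0 \<or> h = \<rho> powr (2 * m + 2) \<and> norm w0 \<le> \<rho>"
          and vert: "\<forall>t. \<forall>h'\<in>{0..h}. \<exists>T\<le>5 * \<rho>. reach m (w0, t) (w0, t + h') T"
          using reach_vertical_bound[OF \<open>0 \<le> m\<close> \<open>0 < norm w0\<close> \<open>0 < h\<close>] by (elim exE conjE)
        define D where "D = \<sigma> + 5 * \<rho>"
        have vert_\<gamma>: "\<exists>T\<le>5 * \<rho>. reach m (\<gamma> u) (\<gamma> v) T" if "\<sigma> \<le> u" "u \<le> v" "v \<le> s" for u v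
        proof -
          \<comment> \<open>At \<open>x = \<sigma>\<close> the flow branch of \<open>gam\<close>
            still applies and has to be matched with the vertical segment.\<close>
          have eq: "\<gamma> x = (w0, snd (expX m \<sigma> (z, t)) + (x - \<sigma>))" if "\<sigma> \<le> x" for x
          proof (cases "x = \<sigma>")
            case True
            then show ?thesis by (simp add: \<gamma>_le w0_def prod_eq_iff fst_expX)
          qed (use \<gamma>_gt[of x] that in \<open>simp add: w0_def\<close>)
          show ?thesis
            using vert[rule_format, of "v - u" "snd (expX m \<sigma> (z, t)) + (u - \<sigma>)"] that eq[of u] eq[of v]
            by (simp add: h_def)
        qed
        have diam: "\<exists>T\<le>D. reach m (\<gamma> u) (\<gamma> v) T" if uv: "0 \<le> u" "u \<le> v" "v \<le> s" for u v
        proof -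
          consider "v \<le> \<sigma>" | "\<sigma> \<le> u" | "u \<le> \<sigma>" "\<sigma> \<le> v" by linarith
          then show ?thesis
          proof cases
            case 1
            then show ?thesis using reach_X[OF uv(1,2)] uv(1) \<open>0 < \<rho>\<close>
              by (intro exI[of _ "v - u"]) (auto simp: D_def)
          next
            case 2
            then obtain T where "T \<le> 5 * \<rho>" "reach m (\<gamma> u) (\<gamma> v) T" using vert_\<gamma> uv by blast
            then show ?thesis using \<open>0 < \<sigma>\<close> by (intro exI[of _ T]) (auto simp: D_def)
          next
            case 3
            then obtain T where "T \<le> 5 * \<rho>" "reach m (\<gamma> \<sigma>) (\<gamma> v) T" using vert_\<gamma>[of \<sigma> v] uv by blast
            then show ?thesis using reach_trans[OF reach_X[OF uv(1) 3(1) order_refl]] uv(1)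
              by (intro exI[of _ "\<sigma> - u + T"]) (auto simp: D_def)
          qed
        qed
        have "0 \<le> D" using \<open>0 < \<sigma>\<close> \<open>0 < \<rho>\<close> by (simp add: D_def)
        define r where "r = lam * D"
        have "r \<le> 1 / 400 * D" unfolding r_def using lam_le \<open>0 \<le> D\<close> by (intro mult_right_mono) auto
        have "0 \<le> r" using \<open>0 < lam\<close> \<open>0 \<le> D\<close> by (simp add: r_def)
        from alt show ?thesis
        proof
          assume small: "h = \<rho>\<^sup>2 * norm w0 powr (2 * m) \<and> \<rho> \<le> norm w0"
          \<comment> \<open>The disc must stay within distance \<open>a\<close> of \<open>z\<close>
            for \<open>near\<close>: from \<open>\<rho> <= norm w0 <= 5 * a / 4\<close> one gets
            \<open>D <= 13 * a / 2\<close>, and \<open>D / 400\<close> fits into the remaining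
            \<open>3 * a / 4\<close>.\<close>
          have "\<sigma> + r \<le> a" using \<open>r \<le> 1 / 400 * D\<close> small w0(1) \<sigma>_le \<open>0 < a\<close> unfolding D_def by argo
          show ?thesis
          proof (rule ball[OF \<open>0 \<le> D\<close> diam, where M = "N + K * P * (\<sigma> + r)"])
            fix w assume "norm (w - fst (\<gamma> s)) \<le> lam * D"
            then have "norm (w - w0) \<le> r" by (simp add: fst_\<gamma> r_def)
            moreover have "w - z = (w - w0) + (w0 - z)" by simp
            ultimately have "norm (w - z) \<le> \<sigma> + r"
              using norm_triangle_ineq[of "w - w0" "w0 - z"] w0_z by simp
            then have "norm (ZF m \<phi> w - ZF m \<phi> z) \<le> K * P * (\<sigma> + r)"
              using \<open>\<sigma> + r \<le> a\<close> \<open>1 \<le> K\<close> \<open>0 < P\<close>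
              by (intro order_trans[OF near mult_left_mono]) auto
            then show "norm (ZF m \<phi> w) \<le> N + K * P * (\<sigma> + r)"
              using norm_triangle_ineq2[of "ZF m \<phi> w" "ZF m \<phi> z"] by (simp add: N_def)
          next
            \<comment> \<open>Replacing the radius of \<open>w0\<close> by that of \<open>z\<close>
              in the vertical gain costs at most the factor \<open>c\<close>, which explains the
              \<open>c\<close> in \<open>lam\<close>.\<close>
            have "(a / 2) powr (2 * m) \<le> norm w0 powr (2 * m)"
              using w0(2) \<sigma>_le \<open>0 < a\<close> \<open>0 \<le> m\<close> by (intro powr_mono2) auto
            then have "P / c \<le> norm w0 powr (2 * m)"
              using \<open>0 < a\<close> by (simp add: P_def c_def powr_divide)
            then have "\<rho>\<^sup>2 * (P / c) \<le> \<rho>\<^sup>2 * norm w0 powr (2 * m)" by (rule mult_left_mono) simp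
            then have "\<rho>\<^sup>2 * (P / c) \<le> h" by (simp only: small)
            have "(N + K * P * (\<sigma> + r)) * r = P * ((5 * K * \<sigma> + K * (lam * (\<sigma> + 5 * \<rho>))) * (lam * (\<sigma> + 5 * \<rho>)))"
              unfolding N_eq r_def D_def by (simp add: algebra_simps)
            also have "\<dots> \<le> P * (K * \<sigma>\<^sup>2 + \<rho>\<^sup>2 / c)"
              unfolding lam_def using \<open>0 < P\<close> \<open>1 \<le> K\<close> \<open>1 \<le> c\<close>
              by (intro mult_left_mono near_ball_estimate) auto
            also have "\<dots> = N / 4 * \<sigma> + \<rho>\<^sup>2 * (P / c)"
              unfolding N_eq by (simp add: power2_eq_square algebra_simps)
            finally have "(N + K * P * (\<sigma> + r)) * r \<le> N / 4 * \<sigma> + h"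
              using \<open>\<rho>\<^sup>2 * (P / c) \<le> h\<close> by linarith
            then show "F (\<gamma> s) + (N + K * P * (\<sigma> + r)) * (lam * D) < 0"
              using F_gt[OF \<open>\<sigma> < s\<close>] by (simp add: r_def h_def)
          qed
        next
          assume large: "h = \<rho> powr (2 * m + 2) \<and> norm w0 \<le> \<rho>"
          \<comment> \<open>Here \<open>\<sigma> <= a / 4 <= norm w0 <= \<rho>\<close>: the flow
            part is no longer than the vertical scale, and the drop \<open>h\<close> alone outweighs
            the variation.\<close>
          have "\<sigma> \<le> \<rho>" using large w0(2) \<sigma>_le \<open>0 < a\<close> by argo
          then have "D \<le> 6 * \<rho>" by (simp add: D_def)
          then have "r \<le> \<rho>" using \<open>r \<le> 1 / 400 * D\<close> \<open>0 < \<rho>\<close> by linarith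
          show ?thesis
          \<comment> \<open>The disc lies in \<open>norm w <= 2 * \<rho>\<close>, where
            \<open>ZF\<close> is at most
            \<open>K0 * (2 * \<rho>)^(2m+1) = 2 * K * \<rho>^(2m+1)\<close>. The variation is then
            at most \<open>12 * (K * lam) * h\<close>, and \<open>12 / 400 < 1\<close>.\<close>
          proof (rule ball[OF \<open>0 \<le> D\<close> diam, where M = "2 * K * \<rho> powr (2 * m) * \<rho>"])
            fix w assume "norm (w - fst (\<gamma> s)) \<le> lam * D"
            then have "norm (w - w0) \<le> r" by (simp add: fst_\<gamma> r_def)
            then have "norm w \<le> 2 * \<rho>"
              using norm_triangle_ineq2[of w w0] large \<open>r \<le> \<rho>\<close> by linarith
            then show "norm (ZF m \<phi> w) \<le> 2 * K * \<rho> powr (2 * m) * \<rho>"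
              using ZF_le[of w "2 * \<rho>"] \<open>0 < \<rho>\<close> by (simp add: K_def c_def powr_mult mult.commute mult.left_commute)
          next
            have h_eq: "h = \<rho> powr (2 * m) * \<rho>\<^sup>2"
              using large \<open>0 < \<rho>\<close> powr_add[of \<rho> "2 * m" 2] by simp
            have "2 * K * \<rho> powr (2 * m) * \<rho> * r \<le> 2 * K * \<rho> powr (2 * m) * \<rho> * (lam * (6 * \<rho>))"
              unfolding r_def using \<open>D \<le> 6 * \<rho>\<close> \<open>0 < lam\<close> \<open>1 \<le> K\<close> \<open>0 < \<rho>\<close>
              by (intro mult_left_mono) auto
            also have "\<dots> = 12 * (K * lam) * h" by (simp add: h_eq power2_eq_square)
            also have "\<dots> \<le> 1 * h"
              using K_lam_le \<open>0 < h\<close> by (intro mult_right_mono) auto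
            finally have "2 * K * \<rho> powr (2 * m) * \<rho> * r \<le> h" by simp
            moreover have "0 < N / 4 * \<sigma>" using \<open>0 < N\<close> \<open>0 < \<sigma>\<close> by simp
            ultimately show "F (\<gamma> s) + 2 * K * \<rho> powr (2 * m) * \<rho> * (lam * D) < 0"
              using F_gt[OF \<open>\<sigma> < s\<close>] unfolding r_def h_def by linarith
          qed
        qed
      qed
    qed
    ultimately show ?thesis unfolding \<gamma>_def by blast
  qed
  then show ?thesis using \<open>0 < eps0\<close> \<open>0 < lam\<close> by blast
qed

end
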